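(* Let $n\ge2$ and let $X^!$ be the cotangent bundle of the variety of full flags in $\mathbb C^n$. Let $s=(s_1,\dots,s_{n-1})\in\mathbb R^{n-1}$ be any big enough slope (not necessarily generic). Then for every permutation $I^!$ of $\{1,\dots,n\}$ the index vertex $\mathsf{Ind}^{!s}_{I^!}$ is (the power series expansion in $z_1^!,\dots,z_{n-1}^!$ of) a rational function of $a_1^!,\dots,a_{n-1}^!$, $z_1^!,\dots,z_{n-1}^!$ and $\sqrt{\hbar^!}$, with coefficients in $\mathbb C(q^{1/2})$.
   Context: **Big enough.** $s$ is *big enough* if $s_i>0$ for all $i$ and $s_i+s_{i+1}+\dots+s_j>j-i-1$ for all $j\ge i$. **Vertex function.** The $\mathsf T^!$-fixed points of $X^!$ are indexed by permutations $I=(I_1,\dots,I_n)$ of $\{1,\dots,n\}$. Variables: $u_1^!,\dots,u_n^!$, $a_i^!=u_i^!/u_{i+1}^!$ ($1\le i\le n-1$), $\hbar^!$, $q$, $z_1^!,\dots,z_{n-1}^!$. Let $C$ be the set of collections of integers $(d_{i,j})_{1\le i\le n-1,\,1\le j\le i}$ such that $d_{i,j}\ge0$ for all $i,j$, and for each $1\le i\le n-2$ there is a subset $\{j_1,\dots,j_i\}\subset\{1,\dots,i+1\}$ of $i$ elements with $d_{i,k}\ge d_{i+1,j_k}$ for all $k$. Let $(x)_d=\varphi(x)/\varphi(xq^d)$, $\varphi(x)=\prod_{i\ge0}(1-xq^i)$ (so $(x)_d=\prod_{i=0}^{d-1}(1-xq^i)$ for $d\ge0$, $(x)_{-d}=\prod_{i=1}^{d}(1-xq^{-i})^{-1}$,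 and $1/(q)_d=0$ for $d<0$). The vertex function of $X^!$ at $I$ is $$V^!_I(\mathbf a^!,\mathbf z^!)=\sum_{(d_{i,j})\in C}\ \prod_{i=1}^{n-1}\prod_{j=1}^i(z^!_i)^{d_{i,j}}\ \prod_{i=1}^{n-2}\prod_{j=1}^i\prod_{k=1}^{i+1}\frac{\big(\hbar^!\frac{u^!_{I_k}}{u^!_{I_j}}\big)_{d_{i,j}-d_{i+1,k}}}{\big(q\frac{u^!_{I_k}}{u^!_{I_j}}\big)_{d_{i,j}-d_{i+1,k}}}\ \prod_{i=1}^{n-1}\prod_{j,k=1}^i\frac{\big(q\frac{u^!_{I_k}}{u^!_{I_j}}\big)_{d_{i,j}-d_{i,k}}}{\big(\hbar^!\frac{u^!_{I_k}}{u^!_{I_j}}\big)_{d_{i,j}-d_{i,k}}}\ \prod_{i=1}^n\prod_{j=1}^{n-1}\frac{\big(\hbar^!\frac{u^!_i}{u^!_{I_j}}\big)_{d_{n-1,j}}}{\big(q\frac{u^!_i}{u^!_{I_j}}\big)_{d_{n-1,j}}} .$$ **Index limit.** $\kappa$ is the invertible change of variables $z_i\mapsto\hbar^!a_i^!$, $a_i\mapsto\frac{\hbar^!}{q}z_i^!$, $\hbar\mapsto q/\hbar^!$, $q\mapsto q$; thus $\kappa^{-1}$ is $\hbar^!\mapsto q/\hbar$, $z_i^!\mapsto\hbar a_i$, $a_i^!\mapsto\hbar z_i/q$. The index limit with respect to $s\in\mathbb R^{n-1}$ of a power series $F(\mathbf a^!,\mathbf z^!)$ in $\mathbf z^!$ with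 coefficients rational functions of $\mathbf a^!,\hbar^!,q$ is $$\kappa\Big(\lim_{q\to0}\ \kappa^{-1}\big(F(\mathbf a^!,\mathbf z^!)\big)\big|_{z_i\to z_iq^{s_i+1},\ 1\le i\le n-1}\Big),$$ the limit being taken coefficientwise in the variables $a_i$ with $z_i,\hbar$ fixed generic. **Index vertex.** For any $s\in\mathbb R^{n-1}$ the index vertex $\mathsf{Ind}^{!s}_{I^!}$ is the index limit of $V^!_{I^!}(\mathbf a^!,\mathbf z^!)$ with respect to $s$ (this limit exists for all $s$). *)

theory Defs
  imports
    "HOL-Analysis.Analysis"
    "HOL-Combinatorics.Permutations"
    "HOL-Library.Poly_Mapping"
begin

section \<open>Slopes\<close>

text \<open>A slope in $\mathbb{R}^{n-1}$ is a function of which only the values at $1, \dots, n-1$ are used.\<close>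

definition big_enough :: "nat \<Rightarrow> (nat \<Rightarrow> real) \<Rightarrow> bool" where
  "big_enough n s \<longleftrightarrow>
     (\<forall>i\<in>{1..n-1}. s i > 0) \<and>
     (\<forall>i\<in>{1..n-1}. \<forall>j\<in>{i..n-1}. (\<Sum>k=i..j. s k) > real j - real i - 1)"


section \<open>The vertex function of the cotangent bundle of the full flag variety\<close>

text \<open>
  \<open>qpoch q x d\<close> is $(x)_d$. For negative $d$ the product for $(q)_d$ has the factor
  \<open>inverse (1 - q / q)\<close>, which is \<open>inverse 0 = 0\<close> here; hence division by \<open>qpoch q q d\<close> also
  yields $0$, which is the convention $1/(q)_d = 0$ for $d < 0$.
\<close>

definition qpoch :: "complex \<Rightarrow> complex \<Rightarrow> int \<Rightarrow> complex" where
  "qpoch q x d =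
     (if d \<ge> 0 then (\<Prod>i<nat d. 1 - x * q ^ i)
      else (\<Prod>i=1..nat (- d). inverse (1 - x / q ^ i)))"

text \<open>
  The families $(d_{i,j})$ indexed by $1 \le j \le i \le n-1$ are functions that vanish outside this
  index range; being integers $\ge 0$, they are taken as natural numbers.
\<close>

definition degree_families :: "nat \<Rightarrow> (nat \<Rightarrow> nat \<Rightarrow> nat) set" where
  "degree_families n =
     {d. (\<forall>i j. \<not> (1 \<le> j \<and> j \<le> i \<and> i \<le> n - 1) \<longrightarrow> d i j = 0) \<and>
         (\<forall>i\<in>{1..n-2}. \<exists>c. inj_on c {1..i} \<and> c ` {1..i} \<subseteq> {1..i+1} \<and>
            (\<forall>k\<in>{1..i}. d i k \<ge> d (i + 1) (c k)))}"

definition vertex_term ::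
  "nat \<Rightarrow> (nat \<Rightarrow> nat) \<Rightarrow> (nat \<Rightarrow> nat \<Rightarrow> nat) \<Rightarrow> (nat \<Rightarrow> complex) \<Rightarrow> complex \<Rightarrow> complex \<Rightarrow> complex" where
  "vertex_term n I d u h q =
     (\<Prod>i=1..n-2. \<Prod>j=1..i. \<Prod>k=1..i+1.
        qpoch q (h * (u (I k) / u (I j))) (int (d i j) - int (d (i+1) k)) /
        qpoch q (q * (u (I k) / u (I j))) (int (d i j) - int (d (i+1) k))) *
     (\<Prod>i=1..n-1. \<Prod>j=1..i. \<Prod>k=1..i.
        qpoch q (q * (u (I k) / u (I j))) (int (d i j) - int (d i k)) /
        qpoch q (h * (u (I k) / u (I j))) (int (d i j) - int (d i k))) *
     (\<Prod>i=1..n. \<Prod>j=1..n-1.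
        qpoch q (h * (u i / u (I j))) (int (d (n-1) j)) /
        qpoch q (q * (u i / u (I j))) (int (d (n-1) j)))"

text \<open>
  A power series in $x_1, \dots, x_{n-1}$ is given by its coefficients, indexed by exponent vectors.
  A coefficient that is a rational function of $b_1, \dots, b_{n-1}$, $\hbar$, $q$ is given by its
  values; they are meaningful only at generic points.
\<close>

type_synonym exponent = "nat \<Rightarrow>\<^sub>0 nat"
type_synonym series = "exponent \<Rightarrow> (nat \<Rightarrow> complex) \<Rightarrow> complex \<Rightarrow> complex \<Rightarrow> complex"

text \<open>
  The variables $u_i$ enter only through their ratios, so they are recovered from
  $a_i = u_i / u_{i+1}$ with the normalisation $u_n = 1$. The coefficient of $z^m$ collects the
  families with $\sum_j d_{i,j} = m_i$; it is $0$ if $m$ involves an index outside $1, \dots, n-1$.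
\<close>

definition vertex :: "nat \<Rightarrow> (nat \<Rightarrow> nat) \<Rightarrow> series" where
  "vertex n I m a h q =
     (\<Sum>d | d \<in> degree_families n \<and> (\<forall>i. Poly_Mapping.lookup m i = (\<Sum>j=1..i. d i j)).
        vertex_term n I d (\<lambda>i. \<Prod>k\<in>{i..<n}. a k) h q)"


section \<open>The index limit\<close>

definition total_degree :: "exponent \<Rightarrow> nat" where
  "total_degree m = (\<Sum>i\<in>Poly_Mapping.keys m. Poly_Mapping.lookup m i)"

text \<open>
  \<open>kappa_inv F\<close> is a series in the variables $a_i$ with coefficients in $z_i$, $\hbar$, $q$, obtained by
  $z_i^! \mapsto \hbar a_i$, $a_i^! \mapsto \hbar z_i / q$, $\hbar^! \mapsto q / \hbar$; the power of
  $\hbar$ comes from the monomial in the series variables. Similarly \<open>kappa\<close> substitutes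
  $a_i \mapsto (\hbar^! / q) z_i^!$, $z_i \mapsto \hbar^! a_i^!$, $\hbar \mapsto q / \hbar^!$.
\<close>

definition kappa_inv :: "series \<Rightarrow> series" where
  "kappa_inv F m z h q = h ^ total_degree m * F m (\<lambda>i. h * z i / q) (q / h) q"

definition kappa :: "series \<Rightarrow> series" where
  "kappa G m a h q = (h / q) ^ total_degree m * G m (\<lambda>i. h * a i) (q / h) q"

text \<open>
  As $q^{s_i + 1}$ has a real exponent, $q$ tends to $0$ along the positive reals. The limit no longer
  depends on $q$, and it exists whenever $z$ and $\hbar$ are generic.
\<close>

definition q_limit :: "(nat \<Rightarrow> real) \<Rightarrow> series \<Rightarrow> series" where
  "q_limit s G m z h _ =
     Lim (at_right 0)
       (\<lambda>t::real. G m (\<lambda>i. z i * of_real (t powr (s i + 1))) h (of_real t))"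

definition index_limit :: "(nat \<Rightarrow> real) \<Rightarrow> series \<Rightarrow> series" where
  "index_limit s F = kappa (q_limit s (kappa_inv F))"

definition index_vertex :: "nat \<Rightarrow> (nat \<Rightarrow> real) \<Rightarrow> (nat \<Rightarrow> nat) \<Rightarrow> series" where
  "index_vertex n s I = index_limit s (vertex n I)"


section \<open>Expansions of rational functions\<close>

text \<open>Multivariate polynomials with variables in \<open>'v\<close> and coefficients in \<open>'c\<close>.\<close>

type_synonym ('v, 'c) mpoly = "('v \<Rightarrow>\<^sub>0 nat) \<Rightarrow>\<^sub>0 'c"

definition mpoly_vars :: "('v, 'c::zero) mpoly \<Rightarrow> 'v set" where
  "mpoly_vars p = (\<Union>m\<in>Poly_Mapping.keys p. Poly_Mapping.keys m)"

definition mpoly_eval :: "('v \<Rightarrow> 'c) \<Rightarrow> ('v, 'c::comm_semiring_1) mpoly \<Rightarrow> 'c" where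
  "mpoly_eval x p =
     (\<Sum>m\<in>Poly_Mapping.keys p.
        Poly_Mapping.lookup p m * (\<Prod>v\<in>Poly_Mapping.keys m. x v ^ Poly_Mapping.lookup m v))"

text \<open>An identity of rational functions is an identity of values off the zeros of some nonzero polynomial.\<close>

definition generically :: "(('v \<Rightarrow> complex) \<Rightarrow> bool) \<Rightarrow> bool" where
  "generically \<Phi> \<longleftrightarrow>
     (\<exists>D :: ('v, complex) mpoly. D \<noteq> 0 \<and> (\<forall>x. mpoly_eval x D \<noteq> 0 \<longrightarrow> \<Phi> x))"

datatype param = Par_a nat | Par_sqrt_hbar | Par_sqrt_q

text \<open>
  A rational function of $a$, $z$, $\sqrt{\hbar}$ over $\mathbb{C}(q^{1/2})$ is, after clearing
  denominators, a quotient $P/Q$ of polynomials in $z$ whose coefficients are complex polynomials in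
  $a$, $\sqrt{\hbar}$, $q^{1/2}$. It has an expansion in $z$ if the constant term of $Q$ is a nonzero
  polynomial in these parameters, and the expansion is then the series $F$ with $Q F = P$.
\<close>

type_synonym zpoly = "(nat, (param, complex) mpoly) mpoly"

definition zpoly_in :: "nat \<Rightarrow> zpoly \<Rightarrow> bool" where
  "zpoly_in n P \<longleftrightarrow>
     mpoly_vars P \<subseteq> {1..n-1} \<and>
     (\<forall>m. mpoly_vars (Poly_Mapping.lookup P m) \<subseteq> Par_a ` {1..n-1} \<union> {Par_sqrt_hbar, Par_sqrt_q})"

definition series_at :: "series \<Rightarrow> exponent \<Rightarrow> (param \<Rightarrow> complex) \<Rightarrow> complex" where
  "series_at F m x = F m (\<lambda>i. x (Par_a i)) ((x Par_sqrt_hbar)\<^sup>2) ((x Par_sqrt_q)\<^sup>2)"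

definition is_rational_expansion :: "nat \<Rightarrow> series \<Rightarrow> bool" where
  "is_rational_expansion n F \<longleftrightarrow>
     (\<exists>P Q. zpoly_in n P \<and> zpoly_in n Q \<and> Poly_Mapping.lookup Q 0 \<noteq> 0 \<and>
        (\<forall>m. generically (\<lambda>x.
           (\<Sum>(e, f) | e + f = m. mpoly_eval x (Poly_Mapping.lookup Q e) * series_at F f x)
             = mpoly_eval x (Poly_Mapping.lookup P m))))"

text \<open>The two sums above over sets given by comprehension are finite.\<close>

lemma finite_exponent_splittings: "finite {(e, f). e + f = (m :: exponent)}"
proof -
  let ?B = "{g :: nat \<Rightarrow> nat. \<forall>i. (i \<in> Poly_Mapping.keys m \<longrightarrow> g i \<in> {..Max (range (Poly_Mapping.lookup m))}) \<and>
                                   (i \<notin> Poly_Mapping.keys m \<longrightarrow> g i = 0)}"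
  have fin_range: "finite (range (Poly_Mapping.lookup m))"
  proof (rule finite_subset)
    show "range (Poly_Mapping.lookup m) \<subseteq> insert 0 (Poly_Mapping.lookup m ` Poly_Mapping.keys m)"
      by (auto simp: in_keys_iff)
  qed simp
  have "finite ?B"
    by (rule finite_set_of_finite_funs) auto
  moreover have "Poly_Mapping.lookup e \<in> ?B" if "e + f = m" for e f :: exponent
  proof -
    have le: "Poly_Mapping.lookup e i \<le> Poly_Mapping.lookup m i" for i
      using that by (auto simp: lookup_add)
    have "Poly_Mapping.lookup m i \<le> Max (range (Poly_Mapping.lookup m))" for i
      using fin_range by (intro Max_ge) auto
    then have "Poly_Mapping.lookup e i \<le> Max (range (Poly_Mapping.lookup m))" for i
      using le order_trans by blast
    moreover have "Poly_Mapping.lookup e i = 0" if "i \<notin> Poly_Mapping.keys m" for i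
      using le[of i] that by (simp add: in_keys_iff)
    ultimately show ?thesis
      by blast
  qed
  ultimately have "finite (Poly_Mapping.lookup ` {e. \<exists>f. e + f = m})"
    by (elim finite_subset[rotated], intro image_subsetI) (elim CollectE exE)
  then have "finite {e. \<exists>f. e + f = m}"
    by (rule finite_imageD) (simp add: inj_on_def)
  then have "finite ({e. \<exists>f. e + f = m} \<times> {e. \<exists>f. e + f = m})"
    by simp
  then show ?thesis
    by (rule rev_finite_subset) (auto intro: add.commute)
qed

lemma finite_vertex_index_set:
  "finite {d. d \<in> degree_families n \<and> (\<forall>i. Poly_Mapping.lookup m i = (\<Sum>j=1..i. d i j))}"
proof -
  let ?S = "{1..n-1} \<times> {1..n-1}"
  let ?M = "\<Sum>i=1..n-1. Poly_Mapping.lookup m i"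
  let ?B = "{g :: nat \<times> nat \<Rightarrow> nat. \<forall>x. (x \<in> ?S \<longrightarrow> g x \<in> {..?M}) \<and> (x \<notin> ?S \<longrightarrow> g x = 0)}"
  have "finite ?B"
    by (rule finite_set_of_finite_funs) auto
  then have "finite (curry ` ?B)"
    by simp
  moreover have "d \<in> curry ` ?B"
    if d: "d \<in> degree_families n" and m: "\<forall>i. Poly_Mapping.lookup m i = (\<Sum>j=1..i. d i j)" for d
  proof
    show "d = curry (case_prod d)"
      by simp
    have z: "d i j = 0" if "\<not> (1 \<le> j \<and> j \<le> i \<and> i \<le> n - 1)" for i j
      using d that by (auto simp: degree_families_def)
    have "d i j \<le> ?M" for i j
    proof (cases "1 \<le> j \<and> j \<le> i \<and> i \<le> n - 1")
      case True
      then have "d i j \<le> Poly_Mapping.lookup m i"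
        using m by (auto intro!: member_le_sum)
      also have "\<dots> \<le> ?M"
        using True by (intro member_le_sum) auto
      finally show ?thesis .
    qed (simp add: z)
    then show "case_prod d \<in> ?B"
      using z by auto
  qed
  ultimately show ?thesis
    by (elim rev_finite_subset) auto
qed

end

theory Submission
  imports Defs
begin

text \<open>
  As $q \to 0$, each quotient $(\hbar^! w)_d / (q w)_d$ tends to a function of $d$ that is constant for
  $d \gg 0$ and geometric for $d \ll 0$. Hence a coefficient of the index vertex is a sum over the
  families $d$ of a term $T(d)$, a product of such functions of the differences of the $d_{i,j}$.
  If all $d_a$ with $a$ in a set $S$ of positions are much larger than the other ones, then
  $p_S T(d) = p'_S T(d - 1_S)$, where $p_S$ and $p'_S$ are monomials in $\hbar^!$ and $q$ that do not
  depend on $d$. A family with a large entry always has such a gap, so multiplication by the product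
  of all $p_S - p'_S z^S$ leaves a polynomial.
\<close>

section \<open>Polynomial and rational functions\<close>

text \<open>The relation between T(d) and T(d - 1_S) holds only if the entries on S lie far above
  all others, and which S qualifies depends on d; hence a product over every nonempty S. Expanding
  it also shifts d by the other chosen subsets, so the gap asked for is enlarged by the largest
  possible shift, at most 2^|A| per entry for the set A of positions. Positions in one row share a
  variable: z^S is the product of z_i over (i,j) in S. The cancellation therefore takes place among
  families, before they are collected by exponent. A second obstacle is that coefficients are given
  by values at points, with junk values where a denominator vanishes. Rationality is thus an
  identity off the zeros of a denominator, and all denominators are kept nonzero at one common
  point. Only finitely many coefficients survive the multiplication, so one denominator clears them
  all.\<close>

definition monom_eval :: "('v \<Rightarrow> 'c::comm_semiring_1) \<Rightarrow> ('v \<Rightarrow>\<^sub>0 nat) \<Rightarrow> 'c" where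
  "monom_eval x m = (\<Prod>v\<in>Poly_Mapping.keys m. x v ^ Poly_Mapping.lookup m v)"

lemma monom_eval_superset:
  assumes "finite K" "Poly_Mapping.keys m \<subseteq> K"
  shows "monom_eval x m = (\<Prod>v\<in>K. x v ^ Poly_Mapping.lookup m v)"
  unfolding monom_eval_def using assms
  by (intro prod.mono_neutral_left) (auto simp: in_keys_iff)

lemma monom_eval_add: "monom_eval x (m + m') = monom_eval x m * monom_eval x m'"
proof -
  let ?K = "Poly_Mapping.keys m \<union> Poly_Mapping.keys m'"
  have "monom_eval x (m + m') = (\<Prod>v\<in>?K. x v ^ Poly_Mapping.lookup (m + m') v)"
    using Poly_Mapping.keys_add[of m m'] by (intro monom_eval_superset) auto
  also have "\<dots> = (\<Prod>v\<in>?K. x v ^ Poly_Mapping.lookup m v) * (\<Prod>v\<in>?K. x v ^ Poly_Mapping.lookup m' v)"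
    by (simp add: lookup_add power_add prod.distrib)
  also have "\<dots> = monom_eval x m * monom_eval x m'"
    by (subst (1 2) monom_eval_superset[where K = ?K]) auto
  finally show ?thesis .
qed

lemma mpoly_eval_superset:
  assumes "finite K" "Poly_Mapping.keys p \<subseteq> K"
  shows "mpoly_eval x p = (\<Sum>m\<in>K. Poly_Mapping.lookup p m * monom_eval x m)"
  unfolding mpoly_eval_def monom_eval_def using assms
  by (intro sum.mono_neutral_left) (auto simp: in_keys_iff)

lemma mpoly_eval_single: "mpoly_eval x (Poly_Mapping.single m c) = c * monom_eval x m"
  by (subst mpoly_eval_superset[where K = "{m}"]) auto

lemma mpoly_eval_0 [simp]: "mpoly_eval x 0 = 0"
  by (simp add: mpoly_eval_def)

lemma mpoly_eval_add: "mpoly_eval x (p + q) = mpoly_eval x p + mpoly_eval x q"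
proof -
  let ?K = "Poly_Mapping.keys p \<union> Poly_Mapping.keys q"
  have "mpoly_eval x (p + q) = (\<Sum>m\<in>?K. Poly_Mapping.lookup (p + q) m * monom_eval x m)"
    using Poly_Mapping.keys_add[of p q] by (intro mpoly_eval_superset) auto
  also have "\<dots> = (\<Sum>m\<in>?K. Poly_Mapping.lookup p m * monom_eval x m)
                 + (\<Sum>m\<in>?K. Poly_Mapping.lookup q m * monom_eval x m)"
    by (simp add: lookup_add algebra_simps sum.distrib)
  also have "\<dots> = mpoly_eval x p + mpoly_eval x q"
    by (subst (1 2) mpoly_eval_superset[where K = ?K]) auto
  finally show ?thesis .
qed

lemma mpoly_eval_sum: "mpoly_eval x (sum f A) = (\<Sum>a\<in>A. mpoly_eval x (f a))"
  by (induction A rule: infinite_finite_induct) (auto simp: mpoly_eval_add)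

lemma sum_single_lookup: "(\<Sum>m\<in>Poly_Mapping.keys p. Poly_Mapping.single m (Poly_Mapping.lookup p m)) = p"
  by (rule poly_mapping_eqI)
     (auto simp: lookup_sum lookup_single when_def in_keys_iff)

lemma mpoly_eval_mult: "mpoly_eval x (p * q) = mpoly_eval x p * mpoly_eval x q"
proof -
  let ?s = "\<lambda>p m. Poly_Mapping.single m (Poly_Mapping.lookup p m)"
  have "mpoly_eval x (p * q) =
      mpoly_eval x ((\<Sum>m\<in>Poly_Mapping.keys p. ?s p m) * (\<Sum>m\<in>Poly_Mapping.keys q. ?s q m))"
    by (simp only: sum_single_lookup)
  also have "\<dots> = (\<Sum>m\<in>Poly_Mapping.keys p. \<Sum>m'\<in>Poly_Mapping.keys q.
      mpoly_eval x (?s p m) * mpoly_eval x (?s q m'))"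
    by (simp add: sum_product mpoly_eval_sum mult_single mpoly_eval_single monom_eval_add mult_ac)
  also have "\<dots> = mpoly_eval x (\<Sum>m\<in>Poly_Mapping.keys p. ?s p m)
                * mpoly_eval x (\<Sum>m\<in>Poly_Mapping.keys q. ?s q m)"
    by (simp add: sum_product mpoly_eval_sum)
  finally show ?thesis
    by (simp only: sum_single_lookup)
qed

lemma mpoly_vars_single: "mpoly_vars (Poly_Mapping.single m c) \<subseteq> Poly_Mapping.keys m"
  by (auto simp: mpoly_vars_def split: if_splits)

lemma mpoly_vars_add: "mpoly_vars (p + q) \<subseteq> mpoly_vars p \<union> mpoly_vars q"
  using Poly_Mapping.keys_add[of p q] by (fastforce simp: mpoly_vars_def)

lemma mpoly_vars_mult: "mpoly_vars (p * q) \<subseteq> mpoly_vars p \<union> mpoly_vars q"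
proof
  fix v assume "v \<in> mpoly_vars (p * q)"
  then obtain m where m: "m \<in> Poly_Mapping.keys (p * q)" "v \<in> Poly_Mapping.keys m"
    by (auto simp: mpoly_vars_def)
  then obtain a b where "m = a + b" "a \<in> Poly_Mapping.keys p" "b \<in> Poly_Mapping.keys q"
    using keys_mult[of p q] by auto
  with m Poly_Mapping.keys_add[of a b] show "v \<in> mpoly_vars p \<union> mpoly_vars q"
    by (auto simp: mpoly_vars_def)
qed

text \<open>Working with values instead of formal polynomials turns the closure properties into
  introduction rules; a formal polynomial is chosen only when the expansion or a generic statement
  asks for one.\<close>

definition poly_fun :: "'v set \<Rightarrow> (('v \<Rightarrow> complex) \<Rightarrow> complex) \<Rightarrow> bool" where
  "poly_fun V g \<longleftrightarrow> (\<exists>p. mpoly_vars p \<subseteq> V \<and> (\<forall>x. mpoly_eval x p = g x))"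

lemma poly_fun_const: "poly_fun V (\<lambda>_. c)"
  unfolding poly_fun_def
  using mpoly_vars_single[of 0 c]
  by (intro exI[of _ "Poly_Mapping.single 0 c"]) (auto simp: mpoly_eval_single monom_eval_def)

lemma poly_fun_var: "v \<in> V \<Longrightarrow> poly_fun V (\<lambda>x. x v)"
  unfolding poly_fun_def
  using mpoly_vars_single[of "Poly_Mapping.single v 1" 1]
  by (intro exI[of _ "Poly_Mapping.single (Poly_Mapping.single v 1) 1"])
     (auto simp: mpoly_eval_single monom_eval_def)

lemma poly_fun_add: "poly_fun V f \<Longrightarrow> poly_fun V g \<Longrightarrow> poly_fun V (\<lambda>x. f x + g x)"
  unfolding poly_fun_def by (metis (no_types, lifting) mpoly_eval_add mpoly_vars_add le_sup_iff order_trans)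

lemma poly_fun_mult: "poly_fun V f \<Longrightarrow> poly_fun V g \<Longrightarrow> poly_fun V (\<lambda>x. f x * g x)"
  unfolding poly_fun_def by (metis (no_types, lifting) mpoly_eval_mult mpoly_vars_mult le_sup_iff order_trans)

lemma poly_fun_uminus: "poly_fun V f \<Longrightarrow> poly_fun V (\<lambda>x. - f x)"
  using poly_fun_mult[OF poly_fun_const[of V "-1"]] by simp

lemma poly_fun_power: "poly_fun V f \<Longrightarrow> poly_fun V (\<lambda>x. f x ^ k)"
  by (induction k) (auto intro: poly_fun_const poly_fun_mult)

lemma poly_fun_prod: "(\<And>a. a \<in> A \<Longrightarrow> poly_fun V (f a)) \<Longrightarrow> poly_fun V (\<lambda>x. \<Prod>a\<in>A. f a x)"
  by (induction A rule: infinite_finite_induct) (auto intro: poly_fun_const poly_fun_mult)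

lemma poly_fun_sum: "(\<And>a. a \<in> A \<Longrightarrow> poly_fun V (f a)) \<Longrightarrow> poly_fun V (\<lambda>x. \<Sum>a\<in>A. f a x)"
  by (induction A rule: infinite_finite_induct) (auto intro: poly_fun_const poly_fun_add)

text \<open>
  Requiring the denominator to be nonzero at one fixed point, rather than to be a nonzero polynomial,
  makes the closure under products immediate.
\<close>

definition rat_fun :: "'v set \<Rightarrow> ('v \<Rightarrow> complex) \<Rightarrow> (('v \<Rightarrow> complex) \<Rightarrow> complex) \<Rightarrow> bool" where
  "rat_fun V pt g \<longleftrightarrow> (\<exists>P D. poly_fun V P \<and> poly_fun V D \<and> D pt \<noteq> 0 \<and>
     (\<forall>x. D x \<noteq> 0 \<longrightarrow> g x = P x / D x))"

lemma rat_fun_poly: "poly_fun V g \<Longrightarrow> rat_fun V pt g"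
  unfolding rat_fun_def by (rule exI[of _ g], rule exI[of _ "\<lambda>_. 1"]) (auto intro: poly_fun_const)

lemma rat_fun_add:
  assumes "rat_fun V pt f" "rat_fun V pt g"
  shows "rat_fun V pt (\<lambda>x. f x + g x)"
proof -
  obtain P D where 1: "poly_fun V P" "poly_fun V D" "D pt \<noteq> 0" "\<And>x. D x \<noteq> 0 \<Longrightarrow> f x = P x / D x"
    using assms(1) by (auto simp: rat_fun_def)
  obtain P' D' where 2: "poly_fun V P'" "poly_fun V D'" "D' pt \<noteq> 0" "\<And>x. D' x \<noteq> 0 \<Longrightarrow> g x = P' x / D' x"
    using assms(2) by (auto simp: rat_fun_def)
  show ?thesis
    unfolding rat_fun_def using 1 2
    by (intro exI[of _ "\<lambda>x. P x * D' x + P' x * D x"] exI[of _ "\<lambda>x. D x * D' x"])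
       (auto intro!: poly_fun_mult poly_fun_add simp: field_simps)
qed

lemma rat_fun_mult:
  assumes "rat_fun V pt f" "rat_fun V pt g"
  shows "rat_fun V pt (\<lambda>x. f x * g x)"
proof -
  obtain P D where 1: "poly_fun V P" "poly_fun V D" "D pt \<noteq> 0" "\<And>x. D x \<noteq> 0 \<Longrightarrow> f x = P x / D x"
    using assms(1) by (auto simp: rat_fun_def)
  obtain P' D' where 2: "poly_fun V P'" "poly_fun V D'" "D' pt \<noteq> 0" "\<And>x. D' x \<noteq> 0 \<Longrightarrow> g x = P' x / D' x"
    using assms(2) by (auto simp: rat_fun_def)
  show ?thesis
    unfolding rat_fun_def using 1 2
    by (intro exI[of _ "\<lambda>x. P x * P' x"] exI[of _ "\<lambda>x. D x * D' x"])
       (auto intro!: poly_fun_mult)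
qed

lemma rat_fun_inverse:
  assumes "rat_fun V pt f" "f pt \<noteq> 0"
  shows "rat_fun V pt (\<lambda>x. inverse (f x))"
proof -
  obtain P D where 1: "poly_fun V P" "poly_fun V D" "D pt \<noteq> 0" "\<And>x. D x \<noteq> 0 \<Longrightarrow> f x = P x / D x"
    using assms(1) by (auto simp: rat_fun_def)
  then have "P pt \<noteq> 0"
    using assms(2) by auto
  \<comment> \<open>The new denominator is \<open>P x * D x\<close> and not just \<open>P x\<close>,
    because the formula for \<open>f x\<close> is available only where \<open>D x\<close> is
    nonzero.\<close>
  then show ?thesis
    unfolding rat_fun_def using 1
    by (intro exI[of _ "\<lambda>x. D x * D x"] exI[of _ "\<lambda>x. P x * D x"])
       (auto intro!: poly_fun_mult)
qed

lemma rat_fun_divide: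
  "rat_fun V pt f \<Longrightarrow> rat_fun V pt g \<Longrightarrow> g pt \<noteq> 0 \<Longrightarrow> rat_fun V pt (\<lambda>x. f x / g x)"
  using rat_fun_mult[OF _ rat_fun_inverse] by (simp add: divide_inverse)

lemma rat_fun_const: "rat_fun V pt (\<lambda>_. c)"
  by (intro rat_fun_poly poly_fun_const)

lemma rat_fun_diff: "rat_fun V pt f \<Longrightarrow> rat_fun V pt g \<Longrightarrow> rat_fun V pt (\<lambda>x. f x - g x)"
  using rat_fun_add[OF _ rat_fun_mult[OF rat_fun_const[of _ _ "-1"]], of V pt f g] by simp

lemma rat_fun_prod: "(\<And>a. a \<in> A \<Longrightarrow> rat_fun V pt (f a)) \<Longrightarrow> rat_fun V pt (\<lambda>x. \<Prod>a\<in>A. f a x)"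
  by (induction A rule: infinite_finite_induct) (auto intro: rat_fun_const rat_fun_mult)

lemma rat_fun_sum: "(\<And>a. a \<in> A \<Longrightarrow> rat_fun V pt (f a)) \<Longrightarrow> rat_fun V pt (\<lambda>x. \<Sum>a\<in>A. f a x)"
  by (induction A rule: infinite_finite_induct) (auto intro: rat_fun_const rat_fun_add)

text \<open>The product of the individual denominators works: it is nonzero at \<open>pt\<close>,
  and at any point where it is nonzero every single formula applies.\<close>

lemma rat_fun_common_denominator:
  assumes "finite A" "\<And>a. a \<in> A \<Longrightarrow> rat_fun V pt (f a)"
  shows "\<exists>D P. poly_fun V D \<and> D pt \<noteq> 0 \<and>
    (\<forall>a\<in>A. poly_fun V (P a) \<and> (\<forall>x. D x \<noteq> 0 \<longrightarrow> D x * f a x = P a x))"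
proof -
  have "\<forall>a\<in>A. \<exists>P D. poly_fun V P \<and> poly_fun V D \<and> D pt \<noteq> 0 \<and> (\<forall>x. D x \<noteq> 0 \<longrightarrow> f a x = P x / D x)"
    using assms(2) by (auto simp: rat_fun_def)
  then obtain P D where PD: "\<forall>a\<in>A. poly_fun V (P a) \<and> poly_fun V (D a) \<and> D a pt \<noteq> 0 \<and>
      (\<forall>x. D a x \<noteq> 0 \<longrightarrow> f a x = P a x / D a x)"
    by metis
  show ?thesis
  proof (intro exI conjI ballI allI impI)
    show "poly_fun V (\<lambda>x. \<Prod>a\<in>A. D a x)"
      using PD by (intro poly_fun_prod) auto
    show "(\<Prod>a\<in>A. D a pt) \<noteq> 0"
      using PD assms(1) by simp
    fix a assume a: "a \<in> A"
    show "poly_fun V (\<lambda>x. P a x * (\<Prod>b\<in>A - {a}. D b x))"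
      using a PD by (intro poly_fun_mult poly_fun_prod) auto
    fix x assume "(\<Prod>a\<in>A. D a x) \<noteq> 0"
    then have "D a x \<noteq> 0"
      using a assms(1) by simp
    with a PD have "f a x = P a x / D a x"
      by blast
    with a assms(1) \<open>D a x \<noteq> 0\<close> show "(\<Prod>a\<in>A. D a x) * f a x = P a x * (\<Prod>b\<in>A - {a}. D b x)"
      by (simp add: prod.remove)
  qed
qed

text \<open>Passage from coefficient functions to the formal polynomials in z that
  \<open>is_rational_expansion\<close> asks for; the finite set \<open>M\<close> supplies the finite
  support.\<close>

lemma zpoly_of_fun:
  assumes "finite M" "\<And>m. m \<in> M \<Longrightarrow> Poly_Mapping.keys m \<subseteq> {1..n-1}"
    and "\<And>m. m \<in> M \<Longrightarrow> poly_fun (Par_a ` {1..n-1} \<union> {Par_sqrt_hbar, Par_sqrt_q}) (G m)"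
    and "\<And>m x. m \<notin> M \<Longrightarrow> G m x = 0"
  shows "\<exists>P. zpoly_in n P \<and> (\<forall>m x. mpoly_eval x (Poly_Mapping.lookup P m) = G m x)"
proof -
  let ?V = "Par_a ` {1..n-1} \<union> {Par_sqrt_hbar, Par_sqrt_q}"
  have "\<forall>m\<in>M. \<exists>p. mpoly_vars p \<subseteq> ?V \<and> (\<forall>x. mpoly_eval x p = G m x)"
    using assms(3) by (simp add: poly_fun_def)
  then obtain c where c: "\<forall>m\<in>M. mpoly_vars (c m) \<subseteq> ?V \<and> (\<forall>x. mpoly_eval x (c m) = G m x)"
    by (rule bchoice[THEN exE])
  define P where "P = Abs_poly_mapping (\<lambda>m. if m \<in> M then c m else 0)"
  have "finite {m. (if m \<in> M then c m else 0) \<noteq> 0}"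
    by (rule finite_subset[OF _ assms(1)]) auto
  then have lookup_P: "Poly_Mapping.lookup P = (\<lambda>m. if m \<in> M then c m else 0)"
    unfolding P_def by (rule lookup_Abs_poly_mapping)
  have "Poly_Mapping.keys P \<subseteq> M"
    by (auto simp: in_keys_iff lookup_P split: if_splits)
  then have "mpoly_vars P \<subseteq> {1..n-1}"
    using assms(2) unfolding mpoly_vars_def by blast
  moreover have "mpoly_vars (Poly_Mapping.lookup P m) \<subseteq> ?V" for m
    using c by (cases "m \<in> M") (auto simp: lookup_P mpoly_vars_def)
  ultimately show ?thesis
    unfolding zpoly_in_def using c assms(4)
    by (intro exI[of _ P]) (auto simp: lookup_P)
qed

section \<open>Families with a gap\<close>

text \<open>Pigeonhole on bins of length \<open>G\<close>: the entries other than
  \<open>amax\<close> occupy at most \<open>card A - 1\<close> of the bins 1, ...,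
  \<open>card A\<close>, so some bin \<open>k\<close> among them is empty, and \<open>amax\<close>
  lies above it. \<open>S\<close> consists of the entries above bin \<open>k\<close>; all others,
  including the zeros outside \<open>A\<close>, are at most \<open>k * G\<close>.\<close>

lemma gap_exists:
  fixes d :: "'a \<Rightarrow> int" and G :: int
  assumes "finite A" "G > 0" "\<And>a. d a \<ge> 0" "\<And>a. a \<notin> A \<Longrightarrow> d a = 0"
    and amax: "amax \<in> A" "d amax \<ge> (int (card A) + 1) * G"
  shows "\<exists>S\<subseteq>A. S \<noteq> {} \<and> (\<forall>a\<in>S. d a \<ge> G \<and> (\<forall>b. b \<notin> S \<longrightarrow> d a - d b \<ge> G))"
proof -
  have "card ((\<lambda>a. d a div G) ` (A - {amax})) \<le> card (A - {amax})"
    using assms(1) by (intro card_image_le) auto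
  also have "\<dots> < card {1..int (card A)}"
    using card_Diff1_less[OF assms(1) amax(1)] by simp
  finally have "\<not> {1..int (card A)} \<subseteq> (\<lambda>a. d a div G) ` (A - {amax})"
    using assms(1) by (metis card_mono finite_Diff finite_imageI not_le)
  then obtain k where k: "1 \<le> k" "k \<le> int (card A)" "k \<notin> (\<lambda>a. d a div G) ` (A - {amax})"
    by (metis atLeastAtMost_iff subsetI)
  have bin_amax: "d amax div G > k"
  proof -
    have "int (card A) + 1 \<le> d amax div G"
      using zdiv_mono1[OF amax(2) assms(2)] assms(2) by simp
    with k show ?thesis by simp
  qed
  have lower: "d a \<ge> (k + 1) * G" if "d a div G > k" for a
  proof -
    have "(k + 1) * G \<le> (d a div G) * G"
      using that assms(2) by (intro mult_right_mono) auto
    also have "\<dots> \<le> d a"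
      using pos_mod_sign[OF assms(2), of "d a"] div_mult_mod_eq[of "d a" G] by linarith
    finally show ?thesis .
  qed
  have upper: "d b \<le> k * G" if "\<not> (b \<in> A \<and> d b div G > k)" for b
  proof (cases "b \<in> A")
    case True
    then have "d b div G < k"
      using that k bin_amax by force
    then have "d b div G + 1 \<le> k" by simp
    then have "(d b div G + 1) * G \<le> k * G"
      using assms(2) by (intro mult_right_mono) auto
    moreover have "d b \<le> (d b div G + 1) * G"
      using pos_mod_bound[OF assms(2), of "d b"] div_mult_mod_eq[of "d b" G]
      unfolding distrib_right mult_1 by linarith
    ultimately show ?thesis by simp
  next
    case False
    then show ?thesis using assms k by simp
  qed
  show ?thesis
  proof (intro exI[of _ "{a \<in> A. d a div G > k}"] conjI ballI allI impI)
    fix a assume a: "a \<in> {a \<in> A. d a div G > k}"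
    have "1 * G \<le> (k + 1) * G"
      using k assms(2) by (intro mult_right_mono) auto
    then show "d a \<ge> G"
      using lower[of a] a by simp
    fix b assume "b \<notin> {a \<in> A. d a div G > k}"
    then show "d a - d b \<ge> G"
      using lower[of a] upper[of b] a by (simp add: algebra_simps)
  qed (use amax bin_amax in auto)
qed

text \<open>Exponent vector of the monomial obtained by choosing the z-term from exactly the factors
  indexed by \<open>B\<close>: the sum of the indicators of the members of \<open>B\<close>. It is
  integer valued because it is subtracted from families.\<close>

definition multiplicity_in :: "'a set set \<Rightarrow> 'a \<Rightarrow> int" where
  "multiplicity_in B a = int (card {S \<in> B. a \<in> S})"

text \<open>A shifted family may have negative entries. Such a family does not occur in the series,
  although \<open>T\<close> itself need not vanish there.\<close>

definition zero_extend :: "(('a \<Rightarrow> int) \<Rightarrow> complex) \<Rightarrow> ('a \<Rightarrow> int) \<Rightarrow> complex" where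
  "zero_extend T d = (if \<forall>a. d a \<ge> 0 then T d else 0)"

lemma multiplicity_in_nonneg [simp]: "multiplicity_in B a \<ge> 0"
  by (simp add: multiplicity_in_def)

lemma multiplicity_in_outside:
  assumes "B \<subseteq> Pow A" "a \<notin> A"
  shows "multiplicity_in B a = 0"
proof -
  have "{S \<in> B. a \<in> S} = {}" using assms by auto
  then show ?thesis unfolding multiplicity_in_def by (simp only:) simp
qed

lemma multiplicity_in_le:
  assumes "finite A" "B \<subseteq> Pow A"
  shows "multiplicity_in B a \<le> 2 ^ card A"
proof -
  have "card {S \<in> B. a \<in> S} \<le> card (Pow A)"
    using assms by (intro card_mono) auto
  then have "int (card {S \<in> B. a \<in> S}) \<le> int (2 ^ card A)"
    using assms(1) by (simp only: card_Pow of_nat_le_iff)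
  then show ?thesis
    by (simp add: multiplicity_in_def)
qed

lemma multiplicity_in_insert:
  assumes "finite B" "S \<notin> B"
  shows "multiplicity_in (insert S B) a = multiplicity_in B a + of_bool (a \<in> S)"
proof -
  have "{U \<in> insert S B. a \<in> U} = {U \<in> B. a \<in> U} \<union> (if a \<in> S then {S} else {})"
    by auto
  then show ?thesis
    using assms by (auto simp: multiplicity_in_def)
qed

text \<open>
  The coefficient of \<open>B\<close> in the expansion of the product of all \<open>p S - p' S * z\<^sup>S\<close> over nonempty
  \<open>S \<subseteq> A\<close>.
\<close>

definition prod_coeff :: "'a set \<Rightarrow> ('a set \<Rightarrow> complex) \<Rightarrow> ('a set \<Rightarrow> complex) \<Rightarrow> 'a set set \<Rightarrow> complex" where
  "prod_coeff A p p' B = (\<Prod>S\<in>Pow A - {{}} - B. p S) * (\<Prod>S\<in>B. - p' S)"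

text \<open>Pairing \<open>B\<close> with \<open>insert S B\<close> isolates the choice made in the
  factor of \<open>S\<close>; in the annihilation below each such pair cancels.\<close>

lemma sum_Pow_remove:
  fixes g :: "'b set \<Rightarrow> 'c::comm_monoid_add"
  assumes "finite U" "S \<in> U"
  shows "(\<Sum>B\<in>Pow U. g B) = (\<Sum>B\<in>Pow (U - {S}). g B + g (insert S B))"
proof -
  have "Pow U = Pow (U - {S}) \<union> insert S ` Pow (U - {S})"
    using Pow_insert[of S "U - {S}"] assms(2) by (simp add: insert_absorb)
  then have "(\<Sum>B\<in>Pow U. g B) = (\<Sum>B\<in>Pow (U - {S}). g B) + (\<Sum>B\<in>insert S ` Pow (U - {S}). g B)"
    using assms(1) by (simp only:) (intro sum.union_disjoint; auto)
  also have "(\<Sum>B\<in>insert S ` Pow (U - {S}). g B) = (\<Sum>B\<in>Pow (U - {S}). g (insert S B))"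
    by (subst sum.reindex) (auto simp: inj_on_def)
  finally show ?thesis
    by (simp add: sum.distrib)
qed

text \<open>
  If \<open>d\<close> has a large entry, then some \<open>S\<close> consists of the entries above a gap, and the gap survives
  subtracting the exponents of the other factors. Hence the factor for this \<open>S\<close> already annihilates.
\<close>

lemma gap_annihilation:
  fixes T :: "('a \<Rightarrow> int) \<Rightarrow> complex" and D :: int
  assumes "finite A" "D \<ge> 0"
    and step: "\<And>S e. S \<subseteq> A \<Longrightarrow> S \<noteq> {} \<Longrightarrow> (\<And>a. e a \<ge> 0) \<Longrightarrow>
       (\<And>a b. a \<in> S \<Longrightarrow> b \<notin> S \<Longrightarrow> e a - e b > D) \<Longrightarrow>
       p S * T e = p' S * T (\<lambda>a. e a - of_bool (a \<in> S))"
    and d: "\<And>a. d a \<ge> 0" "\<And>a. a \<notin> A \<Longrightarrow> d a = 0"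
    and amax: "amax \<in> A" "d amax \<ge> (int (card A) + 1) * (D + 1 + 2 ^ card A)"
  shows "(\<Sum>B\<in>Pow (Pow A - {{}}). prod_coeff A p p' B * zero_extend T (\<lambda>a. d a - multiplicity_in B a)) = 0"
proof -
  let ?U = "Pow A - {{}}"
  \<comment> \<open>The term \<open>2 ^ card A\<close> bounds every multiplicity, so a gap of this
    size is still at least \<open>D + 1\<close> after the shift by any \<open>B\<close>.\<close>
  have "D + 1 + 2 ^ card A > 0"
    using assms(2) by (simp add: add_pos_nonneg)
  from gap_exists[of A _ d amax, OF assms(1) this d amax]
  obtain S where S: "S \<subseteq> A" "S \<noteq> {}" "\<And>a. a \<in> S \<Longrightarrow> d a \<ge> D + 1 + 2 ^ card A"
      "\<And>a b. a \<in> S \<Longrightarrow> b \<notin> S \<Longrightarrow> d a - d b \<ge> D + 1 + 2 ^ card A"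
    by auto
  have "prod_coeff A p p' B * zero_extend T (\<lambda>a. d a - multiplicity_in B a) +
        prod_coeff A p p' (insert S B) * zero_extend T (\<lambda>a. d a - multiplicity_in (insert S B) a) = 0"
    if B: "B \<in> Pow (?U - {S})" for B
  proof -
    have fin: "finite B" "S \<notin> B" "B \<subseteq> Pow A"
      using B assms(1) by (auto intro: finite_subset)
    let ?e = "\<lambda>a. d a - multiplicity_in B a"
    let ?p = "\<Prod>R\<in>?U - {S} - B. p R" and ?p' = "\<Prod>R\<in>B. - p' R"
    have "?U - B = insert S (?U - {S} - B)"
      using S B by auto
    then have coeff1: "prod_coeff A p p' B = p S * ?p * ?p'"
      using assms(1) by (simp add: prod_coeff_def)
    have "?U - insert S B = ?U - {S} - B"
      by auto
    then have coeff2: "prod_coeff A p p' (insert S B) = - p' S * ?p * ?p'"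
      using fin by (simp add: prod_coeff_def)
    have e_insert: "(\<lambda>a. d a - multiplicity_in (insert S B) a) = (\<lambda>a. ?e a - of_bool (a \<in> S))"
      using multiplicity_in_insert[OF fin(1,2)] by (simp add: algebra_simps)
    have e_pos: "?e a \<ge> D + 1" if "a \<in> S" for a
      using S(3)[OF that] multiplicity_in_le[OF assms(1) fin(3), of a] by simp
    have e_gap: "?e a - ?e b > D" if "a \<in> S" "b \<notin> S" for a b
      using S(4)[OF that] multiplicity_in_le[OF assms(1) fin(3), of a] multiplicity_in_nonneg[of B b]
      by linarith
    \<comment> \<open>Both extensions by zero must cut off at the same families. They do, because
      the entries on \<open>S\<close> stay at least \<open>D + 1\<close> and can be lowered by 1
      without becoming negative.\<close>
    have "(\<forall>a. ?e a - of_bool (a \<in> S) \<ge> 0) \<longleftrightarrow> (\<forall>a. ?e a \<ge> 0)"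
    proof (intro iffI allI)
      fix a assume *: "\<forall>a. ?e a - of_bool (a \<in> S) \<ge> 0"
      show "?e a \<ge> 0"
        using spec[OF *, of a] by (cases "a \<in> S") auto
    next
      fix a assume "\<forall>a. ?e a \<ge> 0"
      then show "?e a - of_bool (a \<in> S) \<ge> 0"
        using e_pos[of a] assms(2) by (cases "a \<in> S") auto
    qed
    then have "p S * zero_extend T ?e = p' S * zero_extend T (\<lambda>a. ?e a - of_bool (a \<in> S))"
      using step[of S ?e] S e_gap by (auto simp: zero_extend_def)
    then have "?p * ?p' * (p S * zero_extend T ?e) =
        ?p * ?p' * (p' S * zero_extend T (\<lambda>a. ?e a - of_bool (a \<in> S)))"
      by simp
    then show ?thesis
      unfolding coeff1 coeff2 e_insert by (simp add: algebra_simps)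
  qed
  then show ?thesis
    using S assms(1) by (subst sum_Pow_remove[of _ S]) auto
qed

section \<open>Degrees of families and multiplication of the associated series\<close>

definition push_exponent :: "('a \<Rightarrow> nat) \<Rightarrow> 'a set \<Rightarrow> ('a \<Rightarrow> int) \<Rightarrow> exponent" where
  "push_exponent \<rho> A d = (\<Sum>a\<in>A. Poly_Mapping.single (\<rho> a) (nat (d a)))"

definition exponent_fibre :: "('a \<Rightarrow> nat) \<Rightarrow> 'a set \<Rightarrow> exponent \<Rightarrow> ('a \<Rightarrow> int) set" where
  "exponent_fibre \<rho> A m =
     {d. (\<forall>a. d a \<ge> 0) \<and> (\<forall>a. a \<notin> A \<longrightarrow> d a = 0) \<and> push_exponent \<rho> A d = m}"

lemma lookup_push_exponent:
  "Poly_Mapping.lookup (push_exponent \<rho> A d) i = (\<Sum>a\<in>A. if \<rho> a = i then nat (d a) else 0)"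
  by (simp add: push_exponent_def lookup_sum lookup_single when_def)

text \<open>Nonnegativity matters: \<open>nat\<close> truncates negative entries, and additivity
  would be lost.\<close>

lemma push_exponent_add:
  assumes "\<And>a. d a \<ge> 0" "\<And>a. d' a \<ge> 0"
  shows "push_exponent \<rho> A (\<lambda>a. d a + d' a) = push_exponent \<rho> A d + push_exponent \<rho> A d'"
  using assms by (simp add: push_exponent_def nat_add_distrib single_add sum.distrib)

lemma keys_push_exponent: "Poly_Mapping.keys (push_exponent \<rho> A d) \<subseteq> \<rho> ` A"
proof
  fix i assume "i \<in> Poly_Mapping.keys (push_exponent \<rho> A d)"
  then have "(\<Sum>a\<in>A. if \<rho> a = i then nat (d a) else 0) \<noteq> 0"
    unfolding in_keys_iff lookup_push_exponent .
  then obtain a where "a \<in> A" "(if \<rho> a = i then nat (d a) else 0) \<noteq> 0"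
    by (rule sum.not_neutral_contains_not_neutral)
  then show "i \<in> \<rho> ` A"
    by (auto split: if_splits)
qed

lemma lookup_push_exponent_ge:
  assumes "finite A" "a \<in> A"
  shows "nat (d a) \<le> Poly_Mapping.lookup (push_exponent \<rho> A d) (\<rho> a)"
proof -
  have "(if \<rho> a = \<rho> a then nat (d a) else 0) \<le> (\<Sum>b\<in>A. if \<rho> b = \<rho> a then nat (d b) else 0)"
    using assms by (intro member_le_sum) auto
  then show ?thesis
    by (simp add: lookup_push_exponent)
qed

lemma finite_bounded_functions:
  fixes N :: int
  assumes "finite A"
  shows "finite {d :: 'a \<Rightarrow> int. (\<forall>a. d a \<ge> 0) \<and> (\<forall>a. a \<notin> A \<longrightarrow> d a = 0) \<and> (\<forall>a\<in>A. d a \<le> N)}"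
  by (rule finite_subset[OF _ finite_set_of_finite_funs[OF assms, of "{0..N}" 0]]) auto

lemma finite_exponent_fibre:
  assumes "finite A"
  shows "finite (exponent_fibre \<rho> A m)"
proof (rule finite_subset[OF _ finite_bounded_functions[OF assms]])
  let ?N = "\<Sum>a\<in>A. int (Poly_Mapping.lookup m (\<rho> a))"
  show "exponent_fibre \<rho> A m \<subseteq> {d. (\<forall>a. d a \<ge> 0) \<and> (\<forall>a. a \<notin> A \<longrightarrow> d a = 0) \<and> (\<forall>a\<in>A. d a \<le> ?N)}"
  proof safe
    fix d a assume d: "d \<in> exponent_fibre \<rho> A m" and a: "a \<in> A"
    have "d a \<le> int (Poly_Mapping.lookup m (\<rho> a))"
      using lookup_push_exponent_ge[OF assms a, of d \<rho>] d by (simp add: exponent_fibre_def)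
    also have "\<dots> \<le> ?N"
      using assms a by (intro member_le_sum) auto
    finally show "d a \<le> ?N" .
  qed (auto simp: exponent_fibre_def)
qed

text \<open>The left side is the coefficient at \<open>m\<close> of a product of two series. Each
  pair of a choice \<open>B\<close> and a family \<open>d\<close> is reindexed by the family
  \<open>d\<close> plus \<open>multiplicity_in B\<close>, so that for a fixed family all choices
  \<open>B\<close> stand together and can cancel.\<close>

lemma convolution_push_exponent:
  fixes c :: "'a set set \<Rightarrow> complex"
  assumes "finite A" "U \<subseteq> Pow A"
  shows "(\<Sum>(e, f) | e + f = m.
            (\<Sum>B | B \<in> Pow U \<and> push_exponent \<rho> A (multiplicity_in B) = e. c B) *
            (\<Sum>d\<in>exponent_fibre \<rho> A f. T d)) =
         (\<Sum>d\<in>exponent_fibre \<rho> A m. \<Sum>B\<in>Pow U.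
            c B * zero_extend T (\<lambda>a. d a - multiplicity_in B a))"
    (is "?lhs = ?rhs")
proof -
  let ?X = "\<lambda>p. {B. B \<in> Pow U \<and> push_exponent \<rho> A (multiplicity_in B) = fst p} \<times> exponent_fibre \<rho> A (snd p)"
  let ?P = "SIGMA p : {(e, f). e + f = m}. ?X p"
  let ?R = "{(d, B) \<in> exponent_fibre \<rho> A m \<times> Pow U. \<forall>a. multiplicity_in B a \<le> d a}"
  have finU: "finite (Pow U)"
    using assms by (simp add: finite_subset)
  have finX: "finite (?X p)" for p
    using finU finite_exponent_fibre[OF assms(1)] by simp
  have "?lhs = (\<Sum>p | fst p + snd p = m. \<Sum>(B, d)\<in>?X p. c B * T d)"
    by (auto simp: sum_product sum.cartesian_product case_prod_beta intro!: sum.cong)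
  also have "{p. fst p + snd p = m} = {(e, f). e + f = m}"
    by auto
  also have "(\<Sum>p\<in>{(e, f). e + f = m}. \<Sum>(B, d)\<in>?X p. c B * T d) = (\<Sum>(p, B, d)\<in>?P. c B * T d)"
    using finite_exponent_splittings finX by (subst sum.Sigma) (auto simp: case_prod_beta)
  also have "\<dots> = (\<Sum>(d, B)\<in>?R. c B * T (\<lambda>a. d a - multiplicity_in B a))"
  proof (rule sum.reindex_bij_witness[of _
      "\<lambda>(d, B). ((push_exponent \<rho> A (multiplicity_in B), push_exponent \<rho> A (\<lambda>a. d a - multiplicity_in B a)),
                 B, \<lambda>a. d a - multiplicity_in B a)"
      "\<lambda>(p, B, d). (\<lambda>a. d a + multiplicity_in B a, B)"], goal_cases)
    case (2 x)
    then obtain e f B d where x: "x = ((e, f), B, d)"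
      by (metis prod.collapse)
    have "multiplicity_in B a = 0" if "a \<notin> A" for a
      using 2 assms that by (intro multiplicity_in_outside[of _ A]) (auto simp: x)
    with 2 show ?case
      by (auto simp: x exponent_fibre_def push_exponent_add add.commute)
  next
    case (4 x)
    then obtain B d where x: "x = (d, B)"
      by (metis prod.collapse)
    have mult0: "multiplicity_in B a = 0" if "a \<notin> A" for a
      using 4 assms that by (intro multiplicity_in_outside[of _ A]) (auto simp: x)
    have "push_exponent \<rho> A (multiplicity_in B) + push_exponent \<rho> A (\<lambda>a. d a - multiplicity_in B a)
        = push_exponent \<rho> A (\<lambda>a. multiplicity_in B a + (d a - multiplicity_in B a))"
      using 4 by (intro push_exponent_add[symmetric]) (auto simp: x)
    with 4 mult0 show ?case
      by (auto simp: x exponent_fibre_def)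
  qed (auto simp: exponent_fibre_def)
  \<comment> \<open>The pairs added here have a negative entry after the shift, and
    \<open>zero_extend\<close> gives them the value 0.\<close>
  also have "\<dots> = (\<Sum>(d, B)\<in>exponent_fibre \<rho> A m \<times> Pow U. c B * zero_extend T (\<lambda>a. d a - multiplicity_in B a))"
    using finU finite_exponent_fibre[OF assms(1)]
    by (intro sum.mono_neutral_cong_left) (auto simp: zero_extend_def split: if_splits)
  also have "\<dots> = ?rhs"
    by (simp add: sum.cartesian_product)
  finally show ?thesis .
qed

section \<open>Lattice sums\<close>

lemma nonzero_mpoly_of_eval: "mpoly_eval x p \<noteq> 0 \<Longrightarrow> p \<noteq> 0"
  by auto

lemma generically_of_poly_fun:
  assumes "poly_fun V E" "E pt \<noteq> 0" "\<And>x. E x \<noteq> 0 \<Longrightarrow> \<Phi> x"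
  shows "generically \<Phi>"
proof -
  obtain D where "\<And>x. mpoly_eval x D = E x"
    using assms(1) by (auto simp: poly_fun_def)
  then show ?thesis
    unfolding generically_def using assms(2,3) by (metis nonzero_mpoly_of_eval)
qed

text \<open>\<open>E\<close> excludes the points where the shift relation or the formula for the
  series may fail, while \<open>pt\<close> certifies that the polynomials in play are nonzero. The
  denominator is the product of all factors times a polynomial \<open>Den\<close> in the parameters
  that clears the remaining coefficients.\<close>

theorem is_rational_expansion_lattice_sum:
  fixes A :: "'a set" and \<rho> :: "'a \<Rightarrow> nat" and T :: "(param \<Rightarrow> complex) \<Rightarrow> ('a \<Rightarrow> int) \<Rightarrow> complex"
    and p p' :: "'a set \<Rightarrow> (param \<Rightarrow> complex) \<Rightarrow> complex" and n :: nat
  defines "V \<equiv> Par_a ` {1..n-1} \<union> {Par_sqrt_hbar, Par_sqrt_q}"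
  assumes A: "finite A" "\<rho> ` A \<subseteq> {1..n-1}" and D: "D \<ge> 0"
    and p: "\<And>S. S \<subseteq> A \<Longrightarrow> poly_fun V (p S)" "\<And>S. S \<subseteq> A \<Longrightarrow> poly_fun V (p' S)" "\<And>S. S \<subseteq> A \<Longrightarrow> p S pt \<noteq> 0"
    and E: "poly_fun V E" "E pt \<noteq> 0"
    and step: "\<And>x S e. E x \<noteq> 0 \<Longrightarrow> S \<subseteq> A \<Longrightarrow> S \<noteq> {} \<Longrightarrow> (\<And>a. e a \<ge> 0) \<Longrightarrow>
       (\<And>a b. a \<in> S \<Longrightarrow> b \<notin> S \<Longrightarrow> e a - e b > D) \<Longrightarrow>
       p S x * T x e = p' S x * T x (\<lambda>a. e a - of_bool (a \<in> S))"
    and rat: "\<And>d. rat_fun V pt (\<lambda>x. T x d)"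
    and F: "\<And>x m. E x \<noteq> 0 \<Longrightarrow> series_at F m x = (\<Sum>d\<in>exponent_fibre \<rho> A m. T x d)"
  shows "is_rational_expansion n F"
proof -
  define U where "U = Pow A - {{}}"
  \<comment> \<open>The threshold of \<open>gap_annihilation\<close>: a family with an entry of this
    size contributes nothing to the product.\<close>
  define N where "N = (int (card A) + 1) * (D + 1 + 2 ^ card A)"
  define bounded where "bounded = {d :: 'a \<Rightarrow> int. (\<forall>a. d a \<ge> 0) \<and> (\<forall>a. a \<notin> A \<longrightarrow> d a = 0) \<and> (\<forall>a\<in>A. d a \<le> N)}"
  define M where "M = push_exponent \<rho> A ` bounded"
  define c where "c = (\<lambda>x. prod_coeff A (\<lambda>S. p S x) (\<lambda>S. p' S x))"
  define R where "R = (\<lambda>m x. \<Sum>d\<in>exponent_fibre \<rho> A m. \<Sum>B\<in>Pow U.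
      c x B * zero_extend (T x) (\<lambda>a. d a - multiplicity_in B a))"
  have U: "U \<subseteq> Pow A" "finite (Pow U)"
    using A(1) by (auto simp: U_def)
  have finM: "finite M"
    unfolding M_def bounded_def using A(1) by (intro finite_imageI finite_bounded_functions)
  have poly_c: "poly_fun V (\<lambda>x. c x B)" if "B \<in> Pow U" for B
    unfolding c_def prod_coeff_def using that U(1)
    by (intro poly_fun_mult poly_fun_prod poly_fun_uminus p) auto
  have R_outside: "R m x = 0" if "m \<notin> M" "E x \<noteq> 0" for m x
    unfolding R_def
  proof (rule sum.neutral, rule ballI)
    fix d assume d: "d \<in> exponent_fibre \<rho> A m"
    then have d': "\<And>a. d a \<ge> 0" "\<And>a. a \<notin> A \<Longrightarrow> d a = 0"
      by (auto simp: exponent_fibre_def)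
    have "d \<notin> bounded"
      using that d by (auto simp: M_def exponent_fibre_def)
    then obtain a0 where a0: "a0 \<in> A" "d a0 \<ge> N"
      using d' by (auto simp: bounded_def not_le intro: less_imp_le)
    show "(\<Sum>B\<in>Pow U. c x B * zero_extend (T x) (\<lambda>a. d a - multiplicity_in B a)) = 0"
      unfolding c_def U_def
      by (rule gap_annihilation[where D = D and amax = a0])
         (use A(1) D step[OF that(2)] d' a0 in \<open>auto simp: N_def\<close>)
  qed
  have rat_ext: "rat_fun V pt (\<lambda>x. zero_extend (T x) d)" for d
  proof (cases "\<forall>a. d a \<ge> 0")
    case True
    then have "(\<lambda>x. zero_extend (T x) d) = (\<lambda>x. T x d)"
      by (simp add: zero_extend_def)
    then show ?thesis
      using rat by simp
  next
    case False
    then have "(\<lambda>x. zero_extend (T x) d) = (\<lambda>_. 0)"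
      by (simp only: zero_extend_def if_False)
    then show ?thesis
      by (simp add: rat_fun_const)
  qed
  have "rat_fun V pt (R m)" for m
    unfolding R_def by (intro rat_fun_sum rat_fun_mult rat_fun_poly[OF poly_c] rat_ext)
  then obtain Den P where Den: "poly_fun V Den" "Den pt \<noteq> 0"
    and P: "\<And>m. m \<in> M \<Longrightarrow> poly_fun V (P m)" "\<And>m x. m \<in> M \<Longrightarrow> Den x \<noteq> 0 \<Longrightarrow> Den x * R m x = P m x"
    using rat_fun_common_denominator[OF finM, of V pt R] by blast
  define Qf where "Qf = (\<lambda>e x. Den x *
      (\<Sum>B | B \<in> Pow U \<and> push_exponent \<rho> A (multiplicity_in B) = e. c x B))"
  define MQ where "MQ = (\<lambda>B. push_exponent \<rho> A (multiplicity_in B)) ` Pow U"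
  have keys: "Poly_Mapping.keys (push_exponent \<rho> A d) \<subseteq> {1..n-1}" for d
    using keys_push_exponent[of \<rho> A d] A(2) by auto
  \<comment> \<open>Outside \<open>M\<close> the coefficient is set to 0 by hand:
    \<open>R m x\<close> is known to vanish there only if \<open>E x \<noteq> 0\<close>, which is
    enough for a generic identity.\<close>
  have "\<exists>Pz. zpoly_in n Pz \<and> (\<forall>m x. mpoly_eval x (Poly_Mapping.lookup Pz m) = (if m \<in> M then P m x else 0))"
    using finM keys P(1)
    by (intro zpoly_of_fun[where M = M]) (auto simp: M_def V_def simp del: One_nat_def)
  then obtain Pz where Pz: "zpoly_in n Pz"
    "\<And>m x. mpoly_eval x (Poly_Mapping.lookup Pz m) = (if m \<in> M then P m x else 0)"
    by blast
  have "\<exists>Qz. zpoly_in n Qz \<and> (\<forall>m x. mpoly_eval x (Poly_Mapping.lookup Qz m) = Qf m x)"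
  proof (rule zpoly_of_fun[where M = MQ])
    show "finite MQ"
      using U(2) by (simp add: MQ_def)
    show "Poly_Mapping.keys m \<subseteq> {1..n-1}" if "m \<in> MQ" for m
      using that keys by (auto simp: MQ_def simp del: One_nat_def)
    show "poly_fun (Par_a ` {1..n-1} \<union> {Par_sqrt_hbar, Par_sqrt_q}) (Qf m)" for m
      unfolding Qf_def V_def[symmetric] by (intro poly_fun_mult poly_fun_sum Den poly_c) auto
    show "Qf m x = 0" if "m \<notin> MQ" for m x
    proof -
      have "{B. B \<in> Pow U \<and> push_exponent \<rho> A (multiplicity_in B) = m} = {}"
        using that by (auto simp: MQ_def)
      then show ?thesis
        unfolding Qf_def by (simp only: sum.empty mult_zero_right)
    qed
  qed
  then obtain Qz where Qz: "zpoly_in n Qz" "\<And>m x. mpoly_eval x (Poly_Mapping.lookup Qz m) = Qf m x"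
    by blast
  \<comment> \<open>Only the empty choice contributes to the constant term in z, which is therefore
    \<open>Den\<close> times the product of all \<open>p S\<close> and nonzero at
    \<open>pt\<close>.\<close>
  have "B = {}" if B: "B \<in> Pow U" "push_exponent \<rho> A (multiplicity_in B) = 0" for B
  proof (rule ccontr)
    assume "B \<noteq> {}"
    then obtain S where "S \<in> B"
      by blast
    moreover from this have "S \<noteq> {}"
      using B(1) by (auto simp: U_def)
    ultimately obtain a where S: "S \<in> B" "a \<in> S"
      by blast
    then have a: "a \<in> A"
      using B(1) by (auto simp: U_def)
    have "finite B"
      using B(1) A(1) by (auto simp: U_def intro: finite_subset[of B "Pow A"])
    then have "multiplicity_in B a > 0"
      using S by (auto simp: multiplicity_in_def card_gt_0_iff)
    then show False
      using lookup_push_exponent_ge[OF A(1) a, of "multiplicity_in B" \<rho>] B(2) by simp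
  qed
  moreover have "push_exponent \<rho> A (multiplicity_in {}) = 0"
    by (simp add: push_exponent_def multiplicity_in_def)
  ultimately have "{B. B \<in> Pow U \<and> push_exponent \<rho> A (multiplicity_in B) = 0} = {{}}"
    by blast
  then have "Qf 0 pt = Den pt * (\<Prod>S\<in>U. p S pt)"
    by (simp add: Qf_def c_def prod_coeff_def U_def)
  also have "\<dots> \<noteq> 0"
    using Den p(3) U(1) A(1) by (auto simp: U_def)
  finally have "Poly_Mapping.lookup Qz 0 \<noteq> 0"
    using Qz(2)[of pt 0] by auto
  moreover have "generically (\<lambda>x.
      (\<Sum>(e, f) | e + f = m. mpoly_eval x (Poly_Mapping.lookup Qz e) * series_at F f x)
        = mpoly_eval x (Poly_Mapping.lookup Pz m))" for m
  proof (rule generically_of_poly_fun)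
    show "poly_fun V (\<lambda>x. E x * Den x)" "E pt * Den pt \<noteq> 0"
      using E Den by (auto intro: poly_fun_mult)
    fix x assume x: "E x * Den x \<noteq> 0"
    have "(\<Sum>(e, f) | e + f = m. mpoly_eval x (Poly_Mapping.lookup Qz e) * series_at F f x) =
      Den x * (\<Sum>(e, f) | e + f = m. (\<Sum>B | B \<in> Pow U \<and> push_exponent \<rho> A (multiplicity_in B) = e. c x B) *
            (\<Sum>d\<in>exponent_fibre \<rho> A f. T x d))"
      using x by (subst sum_distrib_left, intro sum.cong refl) (auto simp: Qz(2) F Qf_def mult.assoc)
    also have "\<dots> = Den x * R m x"
      unfolding R_def by (subst convolution_push_exponent[OF A(1) U(1)]) simp
    also have "\<dots> = mpoly_eval x (Poly_Mapping.lookup Pz m)"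
      using x P(2) R_outside by (auto simp: Pz(2))
    finally show "(\<Sum>(e, f) | e + f = m. mpoly_eval x (Poly_Mapping.lookup Qz e) * series_at F f x)
        = mpoly_eval x (Poly_Mapping.lookup Pz m)" .
  qed
  ultimately show ?thesis
    unfolding is_rational_expansion_def using Pz(1) Qz(1) by blast
qed

section \<open>Limits of quotients of q-Pochhammer symbols\<close>

text \<open>Limit of (1 - c X t^\<tau>) / (1 - X t^\<tau>) as t tends to 0 from the right.\<close>

definition factor_limit :: "complex \<Rightarrow> complex \<Rightarrow> real \<Rightarrow> complex" where
  "factor_limit c X \<tau> = (if \<tau> > 0 then 1 else if \<tau> < 0 then c else (1 - c * X) / (1 - X))"

text \<open>Limit of (t c w)_k / (t w)_k for w = X t^\<sigma>, with t in the role of q. The first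
  factor has exponent \<open>\<sigma> + 1\<close>, the 1 coming from the factor t in front of
  w.\<close>

definition qpoch_ratio_limit :: "complex \<Rightarrow> complex \<Rightarrow> real \<Rightarrow> int \<Rightarrow> complex" where
  "qpoch_ratio_limit c X \<sigma> k =
     (if k \<ge> 0 then (\<Prod>i<nat k. factor_limit c X (\<sigma> + 1 + real i))
      else (\<Prod>i=1..nat (- k). inverse (factor_limit c X (\<sigma> + 1 - real i))))"

text \<open>
  For \<open>\<tau> = 0\<close> the quotient does not depend on \<open>t\<close>. So the two limits below hold without a genericity
  assumption, also when the junk value of a division by \<open>0\<close> is involved.
\<close>

lemma tendsto_factor:
  fixes X c :: complex and \<tau> :: real
  assumes "X \<noteq> 0" "c \<noteq> 0"
  defines "g \<equiv> \<lambda>t::real. (1 - c * (X * of_real (t powr \<tau>))) / (1 - X * of_real (t powr \<tau>))"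
  shows "(g \<longlongrightarrow> factor_limit c X \<tau>) (at_right 0)"
    and "((\<lambda>t. inverse (g t)) \<longlongrightarrow> inverse (factor_limit c X \<tau>)) (at_right 0)"
proof -
  have powr_0: "((\<lambda>t::real. complex_of_real (t powr a)) \<longlongrightarrow> 0) (at_right 0)" if "a > 0" for a
  proof -
    have "eventually (\<lambda>t::real. 0 \<le> t) (at_right 0)"
      using eventually_at_right_less[of "0::real"] by eventually_elim simp
    then have "((\<lambda>t::real. t powr a) \<longlongrightarrow> 0) (at_right 0)"
      using that by (intro tendsto_zero_powrI[OF tendsto_ident_at tendsto_const])
    then show ?thesis
      using tendsto_of_real[where 'a = complex] by fastforce
  qed
  have pos: "eventually (\<lambda>t::real. t > 0) (at_right 0)"
    by (simp add: eventually_at_right_less)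
  have "(g \<longlongrightarrow> factor_limit c X \<tau>) (at_right 0) \<and>
        ((\<lambda>t. inverse (g t)) \<longlongrightarrow> inverse (factor_limit c X \<tau>)) (at_right 0)"
  proof (cases \<tau> "0 :: real" rule: linorder_cases)
    case equal
    have *: "eventually (\<lambda>t. g t = factor_limit c X \<tau>) (at_right 0)"
      using pos by eventually_elim (simp add: g_def factor_limit_def equal)
    then have "eventually (\<lambda>t. inverse (g t) = inverse (factor_limit c X \<tau>)) (at_right 0)"
      by eventually_elim simp
    with * show ?thesis
      by (auto intro: tendsto_eventually)
  next
    case greater
    have "(g \<longlongrightarrow> (1 - c * (X * 0)) / (1 - X * 0)) (at_right 0)"
      unfolding g_def by (intro tendsto_intros powr_0 greater) simp
    then have "(g \<longlongrightarrow> factor_limit c X \<tau>) (at_right 0)"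
      using greater by (simp add: factor_limit_def)
    then show ?thesis
      using greater tendsto_inverse[of g "factor_limit c X \<tau>"] by (auto simp: factor_limit_def)
  next
    case less
    \<comment> \<open>Numerator and denominator are multiplied by \<open>t powr (- \<tau>)\<close>,
      which tends to 0 because \<open>\<tau>\<close> is negative.\<close>
    let ?f = "\<lambda>t::real. (of_real (t powr (- \<tau>)) - c * X) / (of_real (t powr (- \<tau>)) - X)"
    have "(?f \<longlongrightarrow> (0 - c * X) / (0 - X)) (at_right 0)"
      by (intro tendsto_intros powr_0) (use less assms in auto)
    moreover have "eventually (\<lambda>t. ?f t = g t) (at_right 0)"
      using pos
    proof eventually_elim
      case (elim t)
      define y where "y = complex_of_real (t powr \<tau>)"
      have "y \<noteq> 0"
        using elim by (simp add: y_def)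
      then have "inverse y - c * X = (1 - c * (X * y)) / y" "inverse y - X = (1 - X * y) / y"
        by (simp_all add: field_simps)
      moreover have "complex_of_real (t powr (- \<tau>)) = inverse y"
        by (simp add: y_def powr_minus)
      ultimately have "?f t = ((1 - c * (X * y)) / y) / ((1 - X * y) / y)"
        by (simp only:)
      also have "\<dots> = (1 - c * (X * y)) / (1 - X * y)"
        using \<open>y \<noteq> 0\<close> by simp
      finally show ?case
        by (simp add: g_def y_def)
    qed
    ultimately have "(g \<longlongrightarrow> factor_limit c X \<tau>) (at_right 0)"
      using less assms by (auto simp: factor_limit_def elim: Lim_transform_eventually)
    then show ?thesis
      using less assms tendsto_inverse[of g "factor_limit c X \<tau>"] by (auto simp: factor_limit_def)
  qed
  then show "(g \<longlongrightarrow> factor_limit c X \<tau>) (at_right 0)"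
    and "((\<lambda>t. inverse (g t)) \<longlongrightarrow> inverse (factor_limit c X \<tau>)) (at_right 0)"
    by auto
qed

text \<open>The limit may be 0, so convergence of the inverse does not follow from the first claim;
  both are obtained factor by factor.\<close>

lemma tendsto_qpoch_ratio:
  fixes X c :: complex and \<sigma> :: real and k :: int
  assumes "X \<noteq> 0" "c \<noteq> 0"
  defines "g \<equiv> \<lambda>t::real. qpoch (of_real t) (of_real t * c * (X * of_real (t powr \<sigma>))) k /
                           qpoch (of_real t) (of_real t * (X * of_real (t powr \<sigma>))) k"
  shows "(g \<longlongrightarrow> qpoch_ratio_limit c X \<sigma> k) (at_right 0)"
    and "((\<lambda>t. inverse (g t)) \<longlongrightarrow> inverse (qpoch_ratio_limit c X \<sigma> k)) (at_right 0)"
proof -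
  define f where "f = (\<lambda>\<tau> t::real. (1 - c * (X * of_real (t powr \<tau>))) / (1 - X * complex_of_real (t powr \<tau>)))"
  have f: "(f \<tau> \<longlongrightarrow> factor_limit c X \<tau>) (at_right 0)"
    "((\<lambda>t. inverse (f \<tau> t)) \<longlongrightarrow> inverse (factor_limit c X \<tau>)) (at_right 0)" for \<tau>
    unfolding f_def by (intro tendsto_factor assms)+
  have g: "g t = (if k \<ge> 0 then (\<Prod>i<nat k. f (\<sigma> + 1 + real i) t)
      else (\<Prod>i=1..nat (- k). inverse (f (\<sigma> + 1 - real i) t)))" if "t > 0" for t
  proof (cases "k \<ge> 0")
    case True
    have "complex_of_real (t powr (\<sigma> + 1 + real i)) = of_real (t powr \<sigma>) * of_real t * of_real t ^ i" for i
      using that by (simp add: powr_add powr_realpow)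
    then have "(1 - of_real t * c * (X * of_real (t powr \<sigma>)) * of_real t ^ i) /
       (1 - of_real t * (X * of_real (t powr \<sigma>)) * of_real t ^ i) = f (\<sigma> + 1 + real i) t" for i
      by (simp add: f_def mult_ac)
    then show ?thesis
      using True by (simp add: g_def qpoch_def flip: prod_dividef)
  next
    case False
    have "complex_of_real (t powr (\<sigma> + 1 - real i)) = of_real (t powr \<sigma>) * of_real t / of_real t ^ i" for i
      using that by (simp add: powr_add powr_diff powr_realpow)
    then have "inverse (1 - of_real t * c * (X * of_real (t powr \<sigma>)) / of_real t ^ i) /
       inverse (1 - of_real t * (X * of_real (t powr \<sigma>)) / of_real t ^ i) = inverse (f (\<sigma> + 1 - real i) t)" for i
      by (simp add: f_def mult_ac divide_inverse)
    then show ?thesis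
      using False by (simp add: g_def qpoch_def flip: prod_dividef)
  qed
  have pos: "eventually (\<lambda>t::real. t > 0) (at_right 0)"
    by (simp add: eventually_at_right_less)
  show "(g \<longlongrightarrow> qpoch_ratio_limit c X \<sigma> k) (at_right 0)"
  proof (rule Lim_transform_eventually)
    show "eventually (\<lambda>t. (if k \<ge> 0 then (\<Prod>i<nat k. f (\<sigma> + 1 + real i) t)
      else (\<Prod>i=1..nat (- k). inverse (f (\<sigma> + 1 - real i) t))) = g t) (at_right 0)"
      using pos by eventually_elim (simp only: g)
  qed (auto simp: qpoch_ratio_limit_def intro!: tendsto_prod f)
  show "((\<lambda>t. inverse (g t)) \<longlongrightarrow> inverse (qpoch_ratio_limit c X \<sigma> k)) (at_right 0)"
  proof (rule Lim_transform_eventually)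
    show "eventually (\<lambda>t. (if k \<ge> 0 then (\<Prod>i<nat k. inverse (f (\<sigma> + 1 + real i) t))
      else (\<Prod>i=1..nat (- k). f (\<sigma> + 1 - real i) t)) = inverse (g t)) (at_right 0)"
      using pos by eventually_elim (simp add: g prod_inversef[unfolded comp_def])
  qed (auto simp: qpoch_ratio_limit_def prod_inversef[unfolded comp_def, symmetric] intro!: tendsto_prod f)
qed

section \<open>Behaviour of the limits for differences far from 0\<close>

lemma qpoch_ratio_limit_up:
  assumes "real_of_int D > \<bar>\<sigma>\<bar> + 1" "k > D"
  shows "qpoch_ratio_limit c X \<sigma> k = qpoch_ratio_limit c X \<sigma> (k - 1)"
proof -
  have "real_of_int D < real_of_int k"
    using assms(2) by simp
  then have "k > 0"
    using assms(1) by linarith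
  define j where "j = nat (k - 1)"
  have j: "k = int (Suc j)"
    using \<open>k > 0\<close> by (simp add: j_def)
  have "\<sigma> + 1 + real j > 0"
    using assms(1) \<open>real_of_int D < real_of_int k\<close> by (simp add: j)
  then show ?thesis
    by (simp add: qpoch_ratio_limit_def j nat_add_distrib factor_limit_def)
qed

text \<open>The value at \<open>k\<close> has one more factor than the value at
  \<open>k + 1\<close>, namely the inverse of \<open>factor_limit\<close> at exponent
  \<open>\<sigma> + 1 + k\<close>. This exponent is negative, so the factor is 1/c; it is also the
  reason for the \<open>+ 1\<close> in the threshold.\<close>

lemma qpoch_ratio_limit_down:
  assumes "real_of_int D > \<bar>\<sigma>\<bar> + 1" "k < - D" "c \<noteq> 0"
  shows "c * qpoch_ratio_limit c X \<sigma> k = qpoch_ratio_limit c X \<sigma> (k + 1)"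
proof -
  have "real_of_int k < - real_of_int D"
    using assms(2) by (metis of_int_less_iff of_int_minus)
  then have k: "real_of_int k < - \<bar>\<sigma>\<bar> - 1"
    using assms(1) by simp
  then have "k + 1 < 0"
    by linarith
  define j where "j = nat (- k - 1)"
  have j: "k = - int (Suc j)" "j > 0"
    using \<open>k + 1 < 0\<close> by (auto simp: j_def)
  have "\<sigma> + 1 - real (Suc j) < 0"
    using k by (simp add: j)
  moreover have "nat (- k) = Suc j" "nat (- (k + 1)) = j"
    using j by auto
  ultimately show ?thesis
    using j assms(3) by (simp add: qpoch_ratio_limit_def factor_limit_def del: of_nat_Suc)
qed

text \<open>The factor \<open>i = 1\<close> has exponent 0, where \<open>factor_limit\<close>
  divides by \<open>1 - 1\<close> and so equals 0, as does its inverse. This is the convention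
  1/(q)_d = 0 for d < 0.\<close>

lemma qpoch_ratio_limit_neg_diagonal: "k < 0 \<Longrightarrow> qpoch_ratio_limit c 1 0 k = 0"
  by (auto simp: qpoch_ratio_limit_def factor_limit_def intro!: bexI[of _ 1])

text \<open>Since \<open>c pt = 1\<close>, the value at \<open>pt\<close> is 1 whenever
  \<open>X pt \<noteq> 1\<close>, so the inverse is also rational with a denominator nonzero at
  \<open>pt\<close>. If \<open>X\<close> is constantly 1 and \<open>\<tau> = 0\<close>, division by
  zero makes both functions constantly 0.\<close>

lemma rat_fun_factor_limit:
  assumes "rat_fun V pt c" "rat_fun V pt X" "c pt = 1" "X pt \<noteq> 1 \<or> X = (\<lambda>_. 1)"
  shows "rat_fun V pt (\<lambda>x. factor_limit (c x) (X x) \<tau>)"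
    and "rat_fun V pt (\<lambda>x. inverse (factor_limit (c x) (X x) \<tau>))"
proof -
  have "rat_fun V pt (\<lambda>x. factor_limit (c x) (X x) \<tau>) \<and>
    rat_fun V pt (\<lambda>x. inverse (factor_limit (c x) (X x) \<tau>))"
  proof (cases "X = (\<lambda>_. 1)")
    case True
    then show ?thesis
      using assms(1,3)
      by (cases \<tau> "0::real" rule: linorder_cases)
         (auto simp: factor_limit_def intro!: rat_fun_const rat_fun_inverse)
  next
    case False
    then show ?thesis
      using assms
      by (cases \<tau> "0::real" rule: linorder_cases)
         (auto simp: factor_limit_def intro!: rat_fun_divide rat_fun_const rat_fun_diff rat_fun_mult rat_fun_inverse)
  qed
  then show "rat_fun V pt (\<lambda>x. factor_limit (c x) (X x) \<tau>)"
    and "rat_fun V pt (\<lambda>x. inverse (factor_limit (c x) (X x) \<tau>))"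
    by auto
qed

lemma rat_fun_qpoch_ratio_limit:
  assumes "rat_fun V pt c" "rat_fun V pt X" "c pt = 1" "X pt \<noteq> 1 \<or> X = (\<lambda>_. 1)"
  shows "rat_fun V pt (\<lambda>x. qpoch_ratio_limit (c x) (X x) \<sigma> k)"
    and "rat_fun V pt (\<lambda>x. inverse (qpoch_ratio_limit (c x) (X x) \<sigma> k))"
proof -
  have "rat_fun V pt (\<lambda>x. qpoch_ratio_limit (c x) (X x) \<sigma> k) \<and>
    rat_fun V pt (\<lambda>x. inverse (qpoch_ratio_limit (c x) (X x) \<sigma> k))"
    using rat_fun_factor_limit[OF assms]
    by (cases "k \<ge> 0")
       (auto simp: qpoch_ratio_limit_def prod_inversef[unfolded comp_def, symmetric] intro!: rat_fun_prod)
  then show "rat_fun V pt (\<lambda>x. qpoch_ratio_limit (c x) (X x) \<sigma> k)"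
    and "rat_fun V pt (\<lambda>x. inverse (qpoch_ratio_limit (c x) (X x) \<sigma> k))"
    by auto
qed

text \<open>A difference changes only if \<open>S\<close> separates its source from its target. With
  the source in \<open>S\<close> it exceeds \<open>D\<close> and its factor is stationary; with the
  target in \<open>S\<close> it is below \<open>- D\<close> and its factor changes by a constant
  ratio. \<open>N\<close> counts the latter.\<close>

lemma prod_differences_step:
  fixes \<phi> :: "'r \<Rightarrow> int \<Rightarrow> complex" and e :: "'a \<Rightarrow> int" and src tgt :: "'r \<Rightarrow> 'a"
  assumes "finite R"
    and up: "\<And>r k. r \<in> R \<Longrightarrow> k > D \<Longrightarrow> \<phi> r k = \<phi> r (k - 1)"
    and down: "\<And>r k. r \<in> R \<Longrightarrow> k < - D \<Longrightarrow> g * \<phi> r k = g' * \<phi> r (k + 1)"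
    and gap: "\<And>a b. a \<in> S \<Longrightarrow> b \<notin> S \<Longrightarrow> e a - e b > D"
  defines "N \<equiv> card {r \<in> R. src r \<notin> S \<and> tgt r \<in> S}"
  shows "g ^ N * (\<Prod>r\<in>R. \<phi> r (e (src r) - e (tgt r))) =
    g' ^ N * (\<Prod>r\<in>R. \<phi> r ((e (src r) - of_bool (src r \<in> S)) - (e (tgt r) - of_bool (tgt r \<in> S))))"
proof -
  let ?cross = "\<lambda>r. src r \<notin> S \<and> tgt r \<in> S"
  have pow: "y ^ N = (\<Prod>r\<in>R. if ?cross r then y else 1)" for y :: complex
    using assms(1) by (simp add: N_def prod.If_cases Int_def)
  have "(if ?cross r then g else 1) * \<phi> r (e (src r) - e (tgt r)) = (if ?cross r then g' else 1) *
      \<phi> r ((e (src r) - of_bool (src r \<in> S)) - (e (tgt r) - of_bool (tgt r \<in> S)))"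
    if r: "r \<in> R" for r
  proof (cases "src r \<in> S"; cases "tgt r \<in> S")
    assume "src r \<in> S" "tgt r \<notin> S"
    then show ?thesis
      using up[OF r gap] by (simp add: algebra_simps)
  next
    assume *: "src r \<notin> S" "tgt r \<in> S"
    then have "e (src r) - e (tgt r) < - D"
      using gap[of "tgt r" "src r"] by simp
    from down[OF r this] * show ?thesis
      by (simp add: algebra_simps)
  qed auto
  then show ?thesis
    unfolding pow prod.distrib[symmetric] by (intro prod.cong) auto
qed

section \<open>The index vertex\<close>

definition degree_positions :: "nat \<Rightarrow> (nat \<times> nat) set" where
  "degree_positions n = {(i, j). 1 \<le> j \<and> j \<le> i \<and> i \<le> n - 1}"

definition adjacent_triples :: "nat \<Rightarrow> (nat \<times> nat \<times> nat) set" where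
  "adjacent_triples n = (SIGMA i:{1..n-1}. {1..i} \<times> {1..i+1})"

definition level_triples :: "nat \<Rightarrow> (nat \<times> nat \<times> nat) set" where
  "level_triples n = (SIGMA i:{1..n-1}. {1..i} \<times> {1..i})"

lemma finite_degree_positions [simp]: "finite (degree_positions n)"
  by (rule finite_subset[of _ "{..n} \<times> {..n}"]) (auto simp: degree_positions_def)

lemma finite_adjacent_triples [simp]: "finite (adjacent_triples n)"
  and finite_level_triples [simp]: "finite (level_triples n)"
  by (auto simp: adjacent_triples_def level_triples_def)

lemma prod_triples:
  assumes "finite A" "\<And>i. finite (B i)" "\<And>i. finite (C i)"
  shows "(\<Prod>i\<in>A. \<Prod>j\<in>B i. \<Prod>k\<in>C i. f i j k) = (\<Prod>(i, j, k)\<in>(SIGMA i:A. B i \<times> C i). f i j k)"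
  using assms by (simp add: prod.cartesian_product prod.Sigma case_prod_beta)

text \<open>
  The last product in \<open>vertex_term\<close> becomes the case \<open>i = n - 1\<close> of the first one, with
  \<open>d n k = 0\<close>.
\<close>

lemma vertex_term_eq:
  fixes u :: "nat \<Rightarrow> complex" and h q :: complex
  assumes n: "n \<ge> 2" and I: "I permutes {1..n}" and d: "\<And>k. d n k = 0"
  defines "r \<equiv> \<lambda>j k z. qpoch q (h * (u (I k) / u (I j))) z / qpoch q (q * (u (I k) / u (I j))) z"
  shows "vertex_term n I d u h q =
    (\<Prod>(i, j, k)\<in>adjacent_triples n. r j k (int (d i j) - int (d (i+1) k))) *
    (\<Prod>(i, j, k)\<in>level_triples n. inverse (r j k (int (d i j) - int (d i k))))"
proof -
  \<comment> \<open>The framing weights run over all of 1, ..., n, so \<open>u i\<close> may be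
    replaced by \<open>u (I i)\<close> to match the other factors.\<close>
  have "(\<Prod>i=1..n. \<Prod>j=1..n-1. qpoch q (h * (u i / u (I j))) (int (d (n-1) j)) /
        qpoch q (q * (u i / u (I j))) (int (d (n-1) j))) =
      (\<Prod>i=1..n. \<Prod>j=1..n-1. r j i (int (d (n-1) j)))"
    unfolding r_def by (rule prod.permute[OF I, unfolded comp_def])
  also have "\<dots> = (\<Prod>j=1..n-1. \<Prod>k=1..n-1+1. r j k (int (d (n-1) j) - int (d (n-1+1) k)))"
    using n d by (subst prod.swap) simp
  finally have last: "(\<Prod>i=1..n. \<Prod>j=1..n-1. qpoch q (h * (u i / u (I j))) (int (d (n-1) j)) /
        qpoch q (q * (u i / u (I j))) (int (d (n-1) j))) = \<dots>" .
  have split: "prod f {1..n-1} = prod f {1..n-2} * f (n-1)" for f :: "nat \<Rightarrow> complex"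
  proof -
    have "{1..n-1} = insert (n-1) {1..n-2}" "n - 1 \<notin> {1..n-2}"
      using n by auto
    then show ?thesis
      by (simp only: prod.insert finite_atLeastAtMost not_False_eq_True mult.commute)
  qed
  have "(\<Prod>i=1..n-1. \<Prod>j=1..i. \<Prod>k=1..i+1. r j k (int (d i j) - int (d (i+1) k))) =
      (\<Prod>i=1..n-2. \<Prod>j=1..i. \<Prod>k=1..i+1. r j k (int (d i j) - int (d (i+1) k))) *
      (\<Prod>j=1..n-1. \<Prod>k=1..n-1+1. r j k (int (d (n-1) j) - int (d (n-1+1) k)))"
    by (rule split)
  moreover have "(\<Prod>i=1..n-1. \<Prod>j=1..i. \<Prod>k=1..i+1. r j k (int (d i j) - int (d (i+1) k))) =
      (\<Prod>(i, j, k)\<in>adjacent_triples n. r j k (int (d i j) - int (d (i+1) k)))"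
    unfolding adjacent_triples_def by (rule prod_triples) auto
  moreover have "(\<Prod>i=1..n-1. \<Prod>j=1..i. \<Prod>k=1..i. inverse (r j k (int (d i j) - int (d i k)))) =
      (\<Prod>(i, j, k)\<in>level_triples n. inverse (r j k (int (d i j) - int (d i k))))"
    unfolding level_triples_def by (rule prod_triples) auto
  ultimately show ?thesis
    unfolding vertex_term_def last by (simp add: r_def mult_ac)
qed

text \<open>After all substitutions the variable u_i is \<open>weight_unit\<close> times t to the
  power \<open>weight_slope\<close>, where t is the variable tending to 0. The \<open>q\<close> here
  is not t: it is the parameter that \<open>kappa\<close> brings back after the limit.\<close>

definition weight_unit :: "nat \<Rightarrow> (nat \<Rightarrow> complex) \<Rightarrow> complex \<Rightarrow> nat \<Rightarrow> complex" where
  "weight_unit n a q i = (\<Prod>k\<in>{i..<n}. q * a k)"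

definition weight_slope :: "nat \<Rightarrow> (nat \<Rightarrow> real) \<Rightarrow> nat \<Rightarrow> real" where
  "weight_slope n s i = (\<Sum>k\<in>{i..<n}. s k)"

text \<open>The diagonal is set to 1 separately so that it is the constant function 1 even at points
  where a weight vanishes and the quotient would be 0.\<close>

definition unit_ratio :: "nat \<Rightarrow> (nat \<Rightarrow> nat) \<Rightarrow> (nat \<Rightarrow> complex) \<Rightarrow> complex \<Rightarrow> nat \<Rightarrow> nat \<Rightarrow> complex" where
  "unit_ratio n I a q j k = (if j = k then 1 else weight_unit n a q (I k) / weight_unit n a q (I j))"

definition slope_gap :: "nat \<Rightarrow> (nat \<Rightarrow> real) \<Rightarrow> (nat \<Rightarrow> nat) \<Rightarrow> nat \<Rightarrow> nat \<Rightarrow> real" where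
  "slope_gap n s I j k = weight_slope n s (I k) - weight_slope n s (I j)"

definition term_limit ::
  "nat \<Rightarrow> (nat \<Rightarrow> real) \<Rightarrow> (nat \<Rightarrow> nat) \<Rightarrow> (nat \<Rightarrow> complex) \<Rightarrow> complex \<Rightarrow> complex \<Rightarrow> (nat \<times> nat \<Rightarrow> int) \<Rightarrow> complex" where
  "term_limit n s I a h q d =
     (let L = (\<lambda>j k. qpoch_ratio_limit (h / q) (unit_ratio n I a q j k) (slope_gap n s I j k)) in
      (\<Prod>(i, j, k)\<in>adjacent_triples n. L j k (d (i, j) - d (i+1, k))) *
      (\<Prod>(i, j, k)\<in>level_triples n. inverse (L j k (d (i, j) - d (i, k)))))"

lemma unit_ratio_nonzero:
  assumes "I permutes {1..n}" "\<And>i. i \<in> {1..n-1} \<Longrightarrow> a i \<noteq> 0" "q \<noteq> 0" "j \<in> {1..n}" "k \<in> {1..n}"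
  shows "unit_ratio n I a q j k \<noteq> 0"
proof -
  have "I j \<ge> 1" "I k \<ge> 1"
    using permutes_in_image[OF assms(1)] assms(4,5) by (metis atLeastAtMost_iff)+
  then show ?thesis
    using assms(2,3) by (auto simp: unit_ratio_def weight_unit_def)
qed

lemma adjacent_triples_range: "(i, j, k) \<in> adjacent_triples n \<Longrightarrow> j \<in> {1..n} \<and> k \<in> {1..n}"
  and level_triples_range: "(i, j, k) \<in> level_triples n \<Longrightarrow> j \<in> {1..n} \<and> k \<in> {1..n}"
  by (auto simp: adjacent_triples_def level_triples_def)

text \<open>The arguments are kept in the form that \<open>kappa\<close>, \<open>q_limit\<close> and
  \<open>kappa_inv\<close> produce. The division by t removes the 1 from the exponent
  \<open>s k + 1\<close>, and the third argument is t times \<open>h / q\<close>, which is where the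
  ratio \<open>h / q\<close> comes from.\<close>

lemma tendsto_vertex_term:
  fixes a :: "nat \<Rightarrow> complex" and d :: "nat \<Rightarrow> nat \<Rightarrow> nat" and h q :: complex
  assumes n: "n \<ge> 2" and I: "I permutes {1..n}" and d: "\<And>k. d n k = 0"
    and nz: "\<And>i. i \<in> {1..n-1} \<Longrightarrow> a i \<noteq> 0" "h \<noteq> 0" "q \<noteq> 0"
  shows "((\<lambda>t::real. vertex_term n I d
            (\<lambda>i. \<Prod>k\<in>{i..<n}. (q / h) * (h * a k * of_real (t powr (s k + 1))) / of_real t)
            (of_real t / (q / h)) (of_real t))
          \<longlongrightarrow> term_limit n s I a h q (\<lambda>(i, j). int (d i j))) (at_right 0)"
proof -
  define u where "u = (\<lambda>(t::real) i. \<Prod>k\<in>{i..<n}. (q / h) * (h * a k * of_real (t powr (s k + 1))) / of_real t)"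
  let ?X = "unit_ratio n I a q" and ?\<sigma> = "slope_gap n s I"
  define g where "g = (\<lambda>j k z (t::real).
    qpoch (of_real t) (of_real t * (h / q) * (?X j k * of_real (t powr ?\<sigma> j k))) z /
    qpoch (of_real t) (of_real t * (?X j k * of_real (t powr ?\<sigma> j k))) z)"
  have lim: "(g j k z \<longlongrightarrow> qpoch_ratio_limit (h / q) (?X j k) (?\<sigma> j k) z) (at_right 0)"
    "((\<lambda>t. inverse (g j k z t)) \<longlongrightarrow> inverse (qpoch_ratio_limit (h / q) (?X j k) (?\<sigma> j k) z)) (at_right 0)"
    if "j \<in> {1..n} \<and> k \<in> {1..n}" for j k z
    unfolding g_def using that nz unit_ratio_nonzero[OF I nz(1,3)]
    by (intro tendsto_qpoch_ratio; simp)+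
  have u_eq: "u t i = weight_unit n a q i * of_real (t powr weight_slope n s i)" if "t > 0" for t i
  proof -
    have "(q / h) * (h * a k * of_real (t powr (s k + 1))) / of_real t = q * a k * of_real (t powr s k)" for k
      using that nz by (simp add: powr_add)
    then have "u t i = weight_unit n a q i * of_real (\<Prod>k\<in>{i..<n}. t powr s k)"
      by (simp add: u_def weight_unit_def prod.distrib)
    also have "(\<Prod>k\<in>{i..<n}. t powr s k) = t powr weight_slope n s i"
      using that by (simp add: weight_slope_def powr_sum)
    finally show ?thesis .
  qed
  have ratio: "u t (I k) / u t (I j) = ?X j k * of_real (t powr ?\<sigma> j k)"
    if "t > 0" "j \<in> {1..n} \<and> k \<in> {1..n}" for t j k
  proof -
    have "I j \<ge> 1"
      using permutes_in_image[OF I] that(2) by (metis atLeastAtMost_iff)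
    then have "weight_unit n a q (I j) \<noteq> 0"
      using nz by (auto simp: weight_unit_def)
    then show ?thesis
      unfolding u_eq[OF that(1)] using that(1)
      by (auto simp: unit_ratio_def slope_gap_def powr_diff)
  qed
  have "eventually (\<lambda>t::real. (\<Prod>(i, j, k)\<in>adjacent_triples n. g j k (int (d i j) - int (d (i+1) k)) t) *
      (\<Prod>(i, j, k)\<in>level_triples n. inverse (g j k (int (d i j) - int (d i k)) t)) =
      vertex_term n I d (u t) (of_real t / (q / h)) (of_real t)) (at_right 0)"
    using eventually_at_right_less[of "0::real"]
  proof eventually_elim
    case (elim t)
    have g_eq: "qpoch (of_real t) (of_real t / (q / h) * (u t (I k) / u t (I j))) z /
        qpoch (of_real t) (of_real t * (u t (I k) / u t (I j))) z = g j k z t"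
      if "j \<in> {1..n} \<and> k \<in> {1..n}" for j k z
      unfolding ratio[OF elim that] g_def by simp
    show ?case
      unfolding vertex_term_eq[OF n I, where d = d, OF d]
    proof (intro arg_cong2[where f = "(*)"] prod.cong refl)
      fix r assume r: "r \<in> adjacent_triples n"
      obtain i j k where "r = (i, j, k)"
        by (rule prod_cases3)
      with g_eq[OF adjacent_triples_range, of i j k] r
      show "(case r of (i, j, k) \<Rightarrow> g j k (int (d i j) - int (d (i+1) k)) t) =
        (case r of (i, j, k) \<Rightarrow>
          qpoch (of_real t) (of_real t / (q / h) * (u t (I k) / u t (I j))) (int (d i j) - int (d (i+1) k)) /
          qpoch (of_real t) (of_real t * (u t (I k) / u t (I j))) (int (d i j) - int (d (i+1) k)))"
        by (simp only: case_prod_conv)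
    next
      fix r assume r: "r \<in> level_triples n"
      obtain i j k where "r = (i, j, k)"
        by (rule prod_cases3)
      with g_eq[OF level_triples_range, of i j k] r
      show "(case r of (i, j, k) \<Rightarrow> inverse (g j k (int (d i j) - int (d i k)) t)) =
        (case r of (i, j, k) \<Rightarrow> inverse (
          qpoch (of_real t) (of_real t / (q / h) * (u t (I k) / u t (I j))) (int (d i j) - int (d i k)) /
          qpoch (of_real t) (of_real t * (u t (I k) / u t (I j))) (int (d i j) - int (d i k))))"
        by (simp only: case_prod_conv)
    qed
  qed
  moreover have "((\<lambda>t. (\<Prod>(i, j, k)\<in>adjacent_triples n. g j k (int (d i j) - int (d (i+1) k)) t) *
      (\<Prod>(i, j, k)\<in>level_triples n. inverse (g j k (int (d i j) - int (d i k)) t)))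
      \<longlongrightarrow> term_limit n s I a h q (\<lambda>(i, j). int (d i j))) (at_right 0)"
    unfolding term_limit_def Let_def case_prod_beta
    by (intro tendsto_mult tendsto_prod)
       (use adjacent_triples_range level_triples_range lim in \<open>simp_all add: split_paired_all\<close>)
  ultimately show ?thesis
    unfolding u_def by (rule Lim_transform_eventually[rotated])
qed

text \<open>The limit is taken termwise; the powers of \<open>q / h\<close> from
  \<open>kappa_inv\<close> and of \<open>h / q\<close> from \<open>kappa\<close> cancel.\<close>

lemma index_vertex_eq:
  assumes n: "n \<ge> 2" and I: "I permutes {1..n}"
    and nz: "\<And>i. i \<in> {1..n-1} \<Longrightarrow> a i \<noteq> 0" "h \<noteq> 0" "q \<noteq> 0"
  shows "index_vertex n s I m a h q =
    (\<Sum>d | d \<in> degree_families n \<and> (\<forall>i. Poly_Mapping.lookup m i = (\<Sum>j=1..i. d i j)).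
       term_limit n s I a h q (\<lambda>(i, j). int (d i j)))"
proof -
  let ?D = "{d. d \<in> degree_families n \<and> (\<forall>i. Poly_Mapping.lookup m i = (\<Sum>j=1..i. d i j))}"
  have zero: "d n k = 0" if "d \<in> ?D" for d k
  proof -
    have "\<not> (1 \<le> k \<and> k \<le> n \<and> n \<le> n - 1)"
      using n by auto
    with that show ?thesis
      unfolding degree_families_def by blast
  qed
  have "((\<lambda>t::real. (q / h) ^ total_degree m * (\<Sum>d\<in>?D. vertex_term n I d
            (\<lambda>i. \<Prod>k\<in>{i..<n}. (q / h) * (h * a k * of_real (t powr (s k + 1))) / of_real t)
            (of_real t / (q / h)) (of_real t)))
     \<longlongrightarrow> (q / h) ^ total_degree m * (\<Sum>d\<in>?D. term_limit n s I a h q (\<lambda>(i, j). int (d i j)))) (at_right 0)"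
    by (intro tendsto_mult tendsto_const tendsto_sum tendsto_vertex_term n I nz zero)
  then have "Lim (at_right 0) (\<lambda>t::real. kappa_inv (vertex n I) m
        (\<lambda>i. h * a i * of_real (t powr (s i + 1))) (q / h) (of_real t)) =
      (q / h) ^ total_degree m * (\<Sum>d\<in>?D. term_limit n s I a h q (\<lambda>(i, j). int (d i j)))"
    unfolding kappa_inv_def vertex_def by (intro tendsto_Lim) auto
  then show ?thesis
    using nz by (simp add: index_vertex_def index_limit_def kappa_def q_limit_def power_divide)
qed

text \<open>
  The factor with \<open>j = k\<close> contains $1/(q)_d$, so a nonzero limit forces \<open>d i j \<ge> d (i+1) j\<close>, and
  then the identity is the injection required in \<open>degree_families\<close>.
\<close>

lemma term_limit_zero:
  assumes "i \<in> {1..n-1}" "j \<in> {1..i}" "d (i, j) < d (i + 1, j)"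
  shows "term_limit n s I a h q d = 0"
proof -
  have "(i, j, j) \<in> adjacent_triples n"
    using assms by (auto simp: adjacent_triples_def)
  moreover have "qpoch_ratio_limit (h / q) (unit_ratio n I a q j j) (slope_gap n s I j j)
      (d (i, j) - d (i + 1, j)) = 0"
    using assms(3) by (simp add: unit_ratio_def slope_gap_def qpoch_ratio_limit_neg_diagonal)
  ultimately have "(\<Prod>(i, j, k)\<in>adjacent_triples n. qpoch_ratio_limit (h / q) (unit_ratio n I a q j k)
      (slope_gap n s I j k) (d (i, j) - d (i + 1, k))) = 0"
    by (intro prod_zero) (auto intro!: bexI[of _ "(i, j, j)"])
  then show ?thesis
    by (simp add: term_limit_def Let_def)
qed

lemma lookup_push_exponent_fst:
  assumes "\<And>x. x \<notin> degree_positions n \<Longrightarrow> d x = 0"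
  shows "Poly_Mapping.lookup (push_exponent fst (degree_positions n) d) i = (\<Sum>j=1..i. nat (d (i, j)))"
proof -
  have "Poly_Mapping.lookup (push_exponent fst (degree_positions n) d) i =
      (\<Sum>x | x \<in> degree_positions n \<and> fst x = i. nat (d x))"
    by (simp add: lookup_push_exponent sum.inter_filter)
  also have "\<dots> = (\<Sum>x\<in>Pair i ` {1..i}. nat (d x))"
  proof (intro sum.mono_neutral_left ballI)
    show "{x \<in> degree_positions n. fst x = i} \<subseteq> Pair i ` {1..i}"
      by (auto simp: degree_positions_def)
    fix x assume "x \<in> Pair i ` {1..i} - {x \<in> degree_positions n. fst x = i}"
    then have "x \<notin> degree_positions n"
      by auto
    then show "nat (d x) = 0"
      by (simp add: assms)
  qed simp
  also have "\<dots> = (\<Sum>j=1..i. nat (d (i, j)))"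
    by (subst sum.reindex) (auto simp: inj_on_def)
  finally show ?thesis .
qed

text \<open>The condition in \<open>degree_families\<close> is in general not stable under adding
  the indicator of a set of positions, whereas the lattice sum needs a domain closed under such
  shifts.\<close>

lemma sum_degree_families_eq:
  "(\<Sum>d | d \<in> degree_families n \<and> (\<forall>i. Poly_Mapping.lookup m i = (\<Sum>j=1..i. d i j)).
       term_limit n s I a h q (\<lambda>(i, j). int (d i j))) =
   (\<Sum>d\<in>exponent_fibre fst (degree_positions n) m. term_limit n s I a h q d)"
proof -
  let ?D = "{d. d \<in> degree_families n \<and> (\<forall>i. Poly_Mapping.lookup m i = (\<Sum>j=1..i. d i j))}"
  let ?F = "exponent_fibre fst (degree_positions n) m"
  let ?to = "\<lambda>d (i::nat, j::nat). int (d i j)" and ?from = "\<lambda>d i j. nat (d (i, j))"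
  have fibre: "(\<forall>x. d x \<ge> 0) \<and> (\<forall>x. x \<notin> degree_positions n \<longrightarrow> d x = 0) \<and>
      (\<forall>i. Poly_Mapping.lookup m i = (\<Sum>j=1..i. nat (d (i, j))))" if "d \<in> ?F" for d
    using that lookup_push_exponent_fst[of n d] by (auto simp: exponent_fibre_def)
  have "(\<Sum>d\<in>?D. term_limit n s I a h q (?to d)) = (\<Sum>d\<in>{d \<in> ?F. ?from d \<in> degree_families n}. term_limit n s I a h q d)"
  proof (rule sum.reindex_bij_witness[of _ ?from ?to], goal_cases)
    case (2 d)
    have "?to d x = 0" if "x \<notin> degree_positions n" for x
      using 2 that by (cases x) (auto simp: degree_positions_def degree_families_def)
    moreover from this have "push_exponent fst (degree_positions n) (?to d) = m"
      using 2 by (intro poly_mapping_eqI) (simp add: lookup_push_exponent_fst)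
    ultimately show ?case
      using 2 by (auto simp: exponent_fibre_def)
  next
    case (4 d)
    then show ?case
      using fibre by auto
  qed (use fibre in auto)
  also have "\<dots> = (\<Sum>d\<in>?F. term_limit n s I a h q d)"
  proof (intro sum.mono_neutral_left ballI)
    fix d assume d: "d \<in> ?F - {d \<in> ?F. ?from d \<in> degree_families n}"
    have "\<exists>i\<in>{1..n-2}. \<exists>j\<in>{1..i}. d (i, j) < d (i + 1, j)"
    proof (rule ccontr)
      assume neg: "\<not> ?thesis"
      have "?from d \<in> degree_families n"
        unfolding degree_families_def
      proof (intro CollectI conjI allI impI ballI)
        fix i j assume "\<not> (1 \<le> j \<and> j \<le> i \<and> i \<le> n - 1)"
        then show "nat (d (i, j)) = 0"
          using fibre[of d] d by (auto simp: degree_positions_def)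
      next
        fix i assume "i \<in> {1..n-2}"
        then show "\<exists>c. inj_on c {1..i} \<and> c ` {1..i} \<subseteq> {1..i+1} \<and>
            (\<forall>k\<in>{1..i}. nat (d (i, k)) \<ge> nat (d (i + 1, c k)))"
          using neg by (intro exI[of _ id]) (auto simp: not_less intro!: nat_mono)
      qed
      with d show False by auto
    qed
    then obtain i j where "i \<in> {1..n-2}" "j \<in> {1..i}" "d (i, j) < d (i + 1, j)"
      by blast
    then show "term_limit n s I a h q d = 0"
      by (intro term_limit_zero[of i n j]) auto
  qed (auto simp: finite_exponent_fibre)
  finally show ?thesis .
qed

text \<open>The number of factors whose difference becomes very negative when \<open>S\<close> lies
  above the gap. The patterns applied to \<open>r\<close> reproduce \<open>src\<close> and
  \<open>tgt\<close> of \<open>prod_differences_step\<close> literally.\<close>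

definition adjacent_crossings :: "nat \<Rightarrow> (nat \<times> nat) set \<Rightarrow> nat" where
  "adjacent_crossings n S = card {r \<in> adjacent_triples n.
     (\<lambda>(i, j, k). (i, j)) r \<notin> S \<and> (\<lambda>(i, j, k). (i + 1, k)) r \<in> S}"

definition level_crossings :: "nat \<Rightarrow> (nat \<times> nat) set \<Rightarrow> nat" where
  "level_crossings n S = card {r \<in> level_triples n.
     (\<lambda>(i, j, k). (i, j)) r \<notin> S \<and> (\<lambda>(i, j, k). (i, k)) r \<in> S}"

text \<open>An adjacent factor with very negative difference z satisfies h L(z) = q L(z + 1). Level
  factors occur inverted, so \<open>h\<close> and \<open>q\<close> trade places for them. Splitting
  \<open>h / q\<close> in this way makes both multipliers monomials.\<close>

lemma term_limit_step:
  assumes nz: "h \<noteq> 0" "q \<noteq> 0"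
    and D: "\<And>j k. j \<in> {1..n} \<Longrightarrow> k \<in> {1..n} \<Longrightarrow> real_of_int D > \<bar>slope_gap n s I j k\<bar> + 1"
    and gap: "\<And>a b. a \<in> S \<Longrightarrow> b \<notin> S \<Longrightarrow> e a - e b > D"
  shows "h ^ adjacent_crossings n S * q ^ level_crossings n S * term_limit n s I a h q e =
    q ^ adjacent_crossings n S * h ^ level_crossings n S * term_limit n s I a h q (\<lambda>x. e x - of_bool (x \<in> S))"
proof -
  define L where "L = (\<lambda>j k. qpoch_ratio_limit (h / q) (unit_ratio n I a q j k) (slope_gap n s I j k))"
  have up: "L j k z = L j k (z - 1)" if "j \<in> {1..n} \<and> k \<in> {1..n}" "z > D" for j k z
    unfolding L_def using that D by (intro qpoch_ratio_limit_up[where D = D]) auto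
  have down: "h * L j k z = q * L j k (z + 1)" if "j \<in> {1..n} \<and> k \<in> {1..n}" "z < - D" for j k z
    using qpoch_ratio_limit_down[of "slope_gap n s I j k" D z "h / q" "unit_ratio n I a q j k"] that D nz
    by (simp add: L_def field_simps)
  have down': "q * inverse (L j k z) = h * inverse (L j k (z + 1))"
    if "j \<in> {1..n} \<and> k \<in> {1..n}" "z < - D" for j k z
  proof -
    have "L j k (z + 1) = h / q * L j k z"
      using down[OF that] nz by (simp add: field_simps)
    then show ?thesis
      using nz by (simp add: divide_inverse)
  qed
  have 1: "h ^ adjacent_crossings n S * (\<Prod>(i, j, k)\<in>adjacent_triples n. L j k (e (i, j) - e (i+1, k))) =
      q ^ adjacent_crossings n S * (\<Prod>(i, j, k)\<in>adjacent_triples n.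
        L j k ((e (i, j) - of_bool ((i, j) \<in> S)) - (e (i+1, k) - of_bool ((i+1, k) \<in> S))))"
    using prod_differences_step[where R = "adjacent_triples n" and \<phi> = "\<lambda>(i, j, k). L j k" and D = D
      and g = h and g' = q and S = S and e = e and src = "\<lambda>(i, j, k). (i, j)" and tgt = "\<lambda>(i, j, k). (i + 1, k)"]
      adjacent_triples_range up down gap
    by (force simp: adjacent_crossings_def case_prod_beta)
  have 2: "q ^ level_crossings n S * (\<Prod>(i, j, k)\<in>level_triples n. inverse (L j k (e (i, j) - e (i, k)))) =
      h ^ level_crossings n S * (\<Prod>(i, j, k)\<in>level_triples n.
        inverse (L j k ((e (i, j) - of_bool ((i, j) \<in> S)) - (e (i, k) - of_bool ((i, k) \<in> S)))))"
    using prod_differences_step[where R = "level_triples n" and \<phi> = "\<lambda>(i, j, k) z. inverse (L j k z)" and D = D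
      and g = q and g' = h and S = S and e = e and src = "\<lambda>(i, j, k). (i, j)" and tgt = "\<lambda>(i, j, k). (i, k)"]
      level_triples_range up down' gap
    by (force simp: level_crossings_def case_prod_beta)
  show ?thesis
    using arg_cong2[of _ _ _ _ "(*)", OF 1 2] by (simp add: term_limit_def L_def mult_ac)
qed

text \<open>A single threshold has to serve all factors of a term, whose slopes differ; the sum of
  all absolute gaps is a crude common bound.\<close>

lemma slope_gap_bound: "\<exists>D::int. D \<ge> 0 \<and> (\<forall>j\<in>{1..n}. \<forall>k\<in>{1..n}. real_of_int D > \<bar>slope_gap n s I j k\<bar> + 1)"
proof -
  let ?B = "\<Sum>(j, k)\<in>{1..n} \<times> {1..n}. \<bar>slope_gap n s I j k\<bar>"
  have "\<bar>slope_gap n s I j k\<bar> \<le> ?B" if "j \<in> {1..n}" "k \<in> {1..n}" for j k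
    using member_le_sum[of "(j, k)" "{1..n} \<times> {1..n}" "\<lambda>(j, k). \<bar>slope_gap n s I j k\<bar>"] that by auto
  moreover have "?B \<ge> 0"
    by (intro sum_nonneg) auto
  moreover have "real_of_int (\<lceil>?B\<rceil> + 2) \<ge> ?B + 2"
    using le_of_int_ceiling[of ?B] by simp
  ultimately show ?thesis
    by (intro exI[of _ "\<lceil>?B\<rceil> + 2"]) (smt (verit) of_int_0_le_iff)
qed

text \<open>At the point with all coordinates 2, both \<open>h\<close> and \<open>q\<close> are 4,
  so \<open>h / q\<close> is 1, and \<open>weight_unit\<close> is \<open>8 ^ (n - i)\<close>. These
  powers are distinct, so no off-diagonal ratio is 1 and every denominator is nonzero.\<close>

lemma rat_fun_term_limit:
  fixes n :: nat
  defines "V \<equiv> Par_a ` {1..n-1} \<union> {Par_sqrt_hbar, Par_sqrt_q}" and "pt \<equiv> \<lambda>_. 2"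
  assumes I: "I permutes {1..n}"
  shows "rat_fun V pt (\<lambda>x. term_limit n s I (\<lambda>i. x (Par_a i)) ((x Par_sqrt_hbar)\<^sup>2) ((x Par_sqrt_q)\<^sup>2) d)"
proof -
  let ?h = "\<lambda>x :: param \<Rightarrow> complex. (x Par_sqrt_hbar)\<^sup>2" and ?q = "\<lambda>x :: param \<Rightarrow> complex. (x Par_sqrt_q)\<^sup>2"
  let ?u = "\<lambda>i x. weight_unit n (\<lambda>i. x (Par_a i)) (?q x) i"
  let ?X = "\<lambda>j k x. unit_ratio n I (\<lambda>i. x (Par_a i)) (?q x) j k"
  have c: "rat_fun V pt (\<lambda>x. ?h x / ?q x)"
    by (intro rat_fun_divide rat_fun_poly poly_fun_power poly_fun_var) (auto simp: V_def pt_def)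
  have u0: "?u i pt = 8 ^ (n - i)" for i
    by (simp add: weight_unit_def pt_def)
  have u: "rat_fun V pt (?u i)" if "i \<ge> 1" for i
    unfolding weight_unit_def using that
    by (intro rat_fun_poly poly_fun_prod poly_fun_mult poly_fun_power poly_fun_var) (auto simp: V_def)
  have X: "rat_fun V pt (?X j k)" "?X j k pt \<noteq> 1 \<or> ?X j k = (\<lambda>_. 1)" if "j \<in> {1..n} \<and> k \<in> {1..n}" for j k
  proof -
    have jk: "I j \<in> {1..n}" "I k \<in> {1..n}"
      using permutes_in_image[OF I] that by auto
    show "rat_fun V pt (?X j k)"
      using jk by (cases "j = k") (auto simp: unit_ratio_def u0 intro!: rat_fun_const rat_fun_divide u)
    show "?X j k pt \<noteq> 1 \<or> ?X j k = (\<lambda>_. 1)"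
    proof (cases "j = k")
      case False
      then have "I j \<noteq> I k"
        using permutes_inj[OF I] by (auto dest: injD)
      then have "n - I j \<noteq> n - I k"
        using jk by auto
      then have "(8::nat) ^ (n - I k) \<noteq> 8 ^ (n - I j)"
        by simp
      then have "of_nat (8 ^ (n - I k)) \<noteq> (of_nat (8 ^ (n - I j)) :: complex)"
        by (simp only: of_nat_eq_iff not_False_eq_True)
      then show ?thesis
        using False by (simp add: unit_ratio_def u0)
    qed (simp add: unit_ratio_def)
  qed
  have c0: "?h pt / ?q pt = 1"
    by (simp add: pt_def)
  have L: "rat_fun V pt (\<lambda>x. qpoch_ratio_limit (?h x / ?q x) (?X j k x) \<sigma> z)"
    "rat_fun V pt (\<lambda>x. inverse (qpoch_ratio_limit (?h x / ?q x) (?X j k x) \<sigma> z))"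
    if "j \<in> {1..n} \<and> k \<in> {1..n}" for j k \<sigma> z
    by (rule rat_fun_qpoch_ratio_limit[OF c X(1)[OF that] c0 X(2)[OF that]])+
  show ?thesis
    unfolding term_limit_def Let_def
  proof (intro rat_fun_mult rat_fun_prod)
    fix r assume r: "r \<in> adjacent_triples n"
    obtain i j k where "r = (i, j, k)"
      by (rule prod_cases3)
    with L(1)[OF adjacent_triples_range, of i j k] r
    show "rat_fun V pt (\<lambda>x. case r of (i, j, k) \<Rightarrow>
        qpoch_ratio_limit (?h x / ?q x) (?X j k x) (slope_gap n s I j k) (d (i, j) - d (i + 1, k)))"
      by (simp only: case_prod_conv)
  next
    fix r assume r: "r \<in> level_triples n"
    obtain i j k where "r = (i, j, k)"
      by (rule prod_cases3)
    with L(2)[OF level_triples_range, of i j k] r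
    show "rat_fun V pt (\<lambda>x. case r of (i, j, k) \<Rightarrow>
        inverse (qpoch_ratio_limit (?h x / ?q x) (?X j k x) (slope_gap n s I j k) (d (i, j) - d (i, k))))"
      by (simp only: case_prod_conv)
  qed
qed

theorem corollary2:
  fixes n :: nat and s :: "nat \<Rightarrow> real" and I :: "nat \<Rightarrow> nat"
  assumes "n \<ge> 2"
    and "big_enough n s"
    and "I permutes {1..n}"
  shows "is_rational_expansion n (index_vertex n s I)"
proof -
  let ?V = "Par_a ` {1..n-1} \<union> {Par_sqrt_hbar, Par_sqrt_q}"
  let ?h = "\<lambda>x :: param \<Rightarrow> complex. (x Par_sqrt_hbar)\<^sup>2" and ?q = "\<lambda>x :: param \<Rightarrow> complex. (x Par_sqrt_q)\<^sup>2"
  obtain D where D: "D \<ge> 0" "\<forall>j\<in>{1..n}. \<forall>k\<in>{1..n}. real_of_int D > \<bar>slope_gap n s I j k\<bar> + 1"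
    using slope_gap_bound by blast
  have V: "finite ?V"
    by simp
  show ?thesis
  \<comment> \<open>\<open>E\<close> is the product of all parameters, so
    \<open>E x \<noteq> 0\<close> supplies the nonvanishing of the a_i, of \<open>h\<close> and of
    \<open>q\<close> under which the limit formula and the shift relation hold.\<close>
  proof (rule is_rational_expansion_lattice_sum[where A = "degree_positions n" and \<rho> = fst and D = D
        and pt = "\<lambda>_. 2" and E = "\<lambda>x. \<Prod>v\<in>?V. x v"
        and T = "\<lambda>x. term_limit n s I (\<lambda>i. x (Par_a i)) (?h x) (?q x)"
        and p = "\<lambda>S x. ?h x ^ adjacent_crossings n S * ?q x ^ level_crossings n S"
        and p' = "\<lambda>S x. ?q x ^ adjacent_crossings n S * ?h x ^ level_crossings n S"], goal_cases)
    case 1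
    show ?case
      by (rule finite_degree_positions)
  next
    case (9 x S e)
    then show ?case
      using D V by (intro term_limit_step[where D = D]) auto
  next
    case (10 d)
    show ?case
      by (rule rat_fun_term_limit[OF assms(3)])
  next
    case (11 x m)
    have a: "x (Par_a i) \<noteq> 0" if "i \<in> {1..n-1}" for i
      using 11 that V by auto
    have hq: "?h x \<noteq> 0" "?q x \<noteq> 0"
      using 11 V by auto
    show ?case
      unfolding series_at_def
      by (rule trans[OF index_vertex_eq[OF assms(1,3) a hq] sum_degree_families_eq])
  qed (use D V in \<open>auto simp: degree_positions_def simp del: One_nat_def
        intro!: poly_fun_mult poly_fun_power poly_fun_prod poly_fun_var\<close>)
qed

end
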